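(* Let $N\ge 1$, let $V$ be a set of $N$ vertices, and let $(\beta_k)_{k\ge1}$ be non-negative reals with $\sum_{k\ge1} k\beta_k<\infty$. Let $\Lambda$ be the Poisson random hypergraph on $V$ with parameters $(\beta_k)$, let $\beta(t)=\sum_{k\ge1}\beta_k t^k$ and $t^*=\inf\{t\ge 0:\beta'(t)+\log(1-t)<0\}$, and assume that $\beta'(t)+\log(1-t)$ has no zeros in $[0,t^* )$. Let $\mathcal{E}(N,k)$ be the number of essential $k$-edges of $\Lambda$ and $\mathcal{E}(N)=\sum_{k=1}^N\mathcal{E}(N,k)$. Then, as $N\to\infty$, the following convergences hold in probability: $$\frac{\mathcal{E}(N,k)}{N}\to k(1-t^* )(t^* )^{k-1}\beta_k \quad\text{for every } k\ge 1,\qquad \frac{\mathcal{E}(N)}{N}\to -(1-t^* )\log(1-t^* ).$$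
   Context: A Poisson random hypergraph on $V$ with parameters $(\beta_k)_{k\ge1}$ is a random map $\Lambda:\mathcal{P}(V)\to\mathbb{Z}^+$ such that the $\Lambda(A)$, $A\subseteq V$, are independent and $\Lambda(A)\sim\mathrm{Poisson}(N\beta_k/\binom{N}{k})$ when $|A|=k$; $\Lambda(A)$ is the number of hyperedges over $A$ (multiple hyperedges allowed), and a hyperedge over a set of size $k$ is a $k$-edge; 1-edges are called patches. Identifiable vertices: repeatedly pick a vertex carrying a patch, delete that vertex and the patch, and collapse every other hyperedge containing it onto its remaining vertices (e.g. a 3-edge over $\{u,v,w\}$ becomes a 2-edge over $\{u,w\}$); continue until no patches remain. The set of vertices removed does not depend on the order of choices; it is the set $V^*(\Lambda)$ of identifiable vertices. A hyperedge is essential if removing it (before the collapse) reduces the number of identifiable vertices. *)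

theory Defs
  imports "HOL-Analysis.Analysis" "HOL-Probability.Probability" "HOL-Library.Multiset"
begin

definition pois :: "real \<Rightarrow> nat pmf" where
  "pois r = (if 0 < r then poisson_pmf r else return_pmf 0)"

(* Vertex set V = {..<N}.  A hypergraph is a map Lambda : P(V) -> nat (multiplicities). *)
definition poisson_hypergraph :: "(nat \<Rightarrow> real) \<Rightarrow> nat \<Rightarrow> (nat set \<Rightarrow> nat) pmf" where
  "poisson_hypergraph beta N =
     Pi_pmf {A. A \<subseteq> {..<N} \<and> A \<noteq> {}} 0
       (\<lambda>A. pois (real N * beta (card A) / real (N choose card A)))"

definition edges_mset :: "nat \<Rightarrow> (nat set \<Rightarrow> nat) \<Rightarrow> nat set multiset" where
  "edges_mset N Lam = (\<Sum>A\<in>Pow {..<N}. replicate_mset (Lam A) A)"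

inductive ident_step :: "nat set multiset \<times> nat set \<Rightarrow> nat set multiset \<times> nat set \<Rightarrow> bool" where
  "{v} \<in># H \<Longrightarrow>
   ident_step (H, S) (image_mset (\<lambda>B. B - {v}) (H - {#{v}#}), insert v S)"

definition ident_terminal :: "nat set multiset \<times> nat set \<Rightarrow> bool" where
  "ident_terminal st \<longleftrightarrow> (\<forall>v. {v} \<notin># fst st)"

(* The set of identifiable vertices: the set of vertices removed by the process run until
   no patch remains (independent of the choices made). *)
definition identifiable :: "nat \<Rightarrow> (nat set \<Rightarrow> nat) \<Rightarrow> nat set" where
  "identifiable N Lam =
     (SOME S. \<exists>H. ident_step\<^sup>*\<^sup>* (edges_mset N Lam, {}) (H, S) \<and> ident_terminal (H, S))"

definition essential_count :: "nat \<Rightarrow> nat \<Rightarrow> (nat set \<Rightarrow> nat) \<Rightarrow> nat" where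
  "essential_count N k Lam =
     (\<Sum>A\<in>{A. A \<subseteq> {..<N} \<and> card A = k}.
        if card (identifiable N (Lam(A := Lam A - 1))) < card (identifiable N Lam)
        then Lam A else 0)"

definition essential_total :: "nat \<Rightarrow> (nat set \<Rightarrow> nat) \<Rightarrow> nat" where
  "essential_total N Lam = (\<Sum>k=1..N. essential_count N k Lam)"

definition beta_fun :: "(nat \<Rightarrow> real) \<Rightarrow> real \<Rightarrow> real" where
  "beta_fun beta t = (\<Sum>k. beta (Suc k) * t ^ Suc k)"

(* t* = inf {t >= 0 : beta'(t) + log(1-t) < 0}; the set is restricted to t < 1 where
   log(1-t) is defined (it is nonempty there, so the infimum is unchanged). *)
definition tstar :: "(nat \<Rightarrow> real) \<Rightarrow> real" where
  "tstar beta = Inf {t. 0 \<le> t \<and> t < 1 \<and> deriv (beta_fun beta) t + ln (1 - t) < 0}"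

definition conv_in_prob :: "(nat \<Rightarrow> 'a pmf) \<Rightarrow> (nat \<Rightarrow> 'a \<Rightarrow> real) \<Rightarrow> real \<Rightarrow> bool" where
  "conv_in_prob P X c \<longleftrightarrow>
     (\<forall>e>0. (\<lambda>N. measure_pmf.prob (P N) {x. \<bar>X N x - c\<bar> > e}) \<longlonglongrightarrow> 0)"

end

theory Submission
  imports Defs
begin

text \<open>
  The identifiable vertices form the least set \<open>S\<close> such that no hyperedge \<open>A\<close> satisfies
  \<open>card (A - S) = 1\<close>. For independent Poisson edges the probability that this set equals \<open>S\<close>
  factors into the probability that the edges inside \<open>S\<close> identify all of \<open>S\<close>, and
  \<open>exp (- (N - n) h n)\<close> with \<open>n = card S\<close>, where \<open>h n\<close> is the total rate of the edges that
  would add a given vertex. Summing to one on every vertex subset, this recursion shows that \<open>h\<close>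
  determines the law. A system of \<open>N\<close> independent thresholds, in which a vertex is present at
  size \<open>n\<close> with probability \<open>1 - exp (- h n)\<close>, has the same \<open>h\<close>; there the size of the final set
  is governed by empirical counts, and Chebyshev's inequality together with
  \<open>h (t N) \<longlonglongrightarrow> \<beta>' t\<close> gives convergence of the density of identifiable vertices to \<open>t*\<close>.

  An edge \<open>A\<close> is essential iff it is simple and pivotal: after its removal exactly one of its
  vertices is not identifiable. Being pivotal does not depend on the multiplicity of \<open>A\<close>, so the
  number of essential edges minus its compensator \<open>(N - n) h n\<close>, with \<open>n\<close> the number of identifiable
  vertices, is a sum of centred multiplicities with integrands of Skorokhod type. By integration by
  parts for Poisson variables its second moment is \<open>O (N)\<close> plus an interaction term for the pairs of
  edges one of which newly identifies a vertex of the other; summed over the first edge, this is the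
  correlation of the closure with a centred sum of independent variables of standard deviation
  \<open>O (sqrt N)\<close>. The compensator has the limiting density \<open>(1 - t*) \<beta>' t*\<close>. Restricting \<open>h\<close> to the
  rates of the \<open>k\<close>-edges gives the count for a fixed \<open>k\<close>.
\<close>

section \<open>Bounded random variables\<close>

lemma bounded_range_of_bool: "bounded (range (\<lambda>x. of_bool (P x) :: real))"
  by (rule boundedI[where B = 1]) auto

lemma bounded_range_mult:
  fixes f g :: "'a \<Rightarrow> real"
  assumes "bounded (range f)" "bounded (range g)"
  shows "bounded (range (\<lambda>x. f x * g x))"
proof -
  obtain a where "\<And>x. \<bar>f x\<bar> \<le> a"
    using assms(1) by (auto simp: bounded_real)
  moreover obtain b where "\<And>x. \<bar>g x\<bar> \<le> b"
    using assms(2) by (auto simp: bounded_real)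
  ultimately have "\<bar>f x * g x\<bar> \<le> a * b" for x
    unfolding abs_mult by (intro mult_mono') auto
  then show ?thesis
    unfolding bounded_real by blast
qed

lemma bounded_range_sum:
  fixes f :: "'i \<Rightarrow> 'a \<Rightarrow> real"
  assumes "\<And>i. i \<in> K \<Longrightarrow> bounded (range (f i))"
  shows "bounded (range (\<lambda>x. \<Sum>i\<in>K. f i x))"
  using assms
proof (induction K rule: infinite_finite_induct)
  case (insert i K)
  then show ?case
    using bounded_plus_comp[of "f i" UNIV "\<lambda>x. \<Sum>j\<in>K. f j x"] by simp
qed simp_all

lemma bounded_range_abs:
  fixes f :: "'a \<Rightarrow> real"
  shows "bounded (range f) \<Longrightarrow> bounded (range (\<lambda>x. \<bar>f x\<bar>))"
  using bounded_norm_comp[of f UNIV] by simp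

lemma bounded_range_power2:
  fixes f :: "'a \<Rightarrow> real"
  shows "bounded (range f) \<Longrightarrow> bounded (range (\<lambda>x. (f x)\<^sup>2))"
  using bounded_range_mult[of f f] by (simp add: power2_eq_square)

lemma bounded_range_const: "bounded (range (\<lambda>_. c))"
  by simp

lemma bounded_range_compose: "bounded (range f) \<Longrightarrow> bounded (range (\<lambda>x. f (g x)))"
  by (rule bounded_subset) auto

lemmas bounded_range_intros = bounded_range_of_bool bounded_range_mult bounded_range_sum
  bounded_range_abs bounded_range_power2 bounded_range_const
  bounded_plus_comp bounded_minus_comp

lemma integrable_measure_pmf_bounded:
  fixes f :: "'a \<Rightarrow> real"
  assumes "bounded (range f)"
  shows "integrable (measure_pmf p) f"
proof -
  obtain B where "\<And>x. \<bar>f x\<bar> \<le> B"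
    using assms by (auto simp: bounded_real)
  then show ?thesis
    by (intro measure_pmf.integrable_const_bound[where B = B]) auto
qed

lemma expectation_of_bool:
  "measure_pmf.expectation p (\<lambda>x. of_bool (P x)) = measure_pmf.prob p {x. P x}"
proof -
  have "(\<lambda>x. of_bool (P x) :: real) = indicat_real {x. P x}"
    by (auto simp: indicator_def)
  then show ?thesis
    by simp
qed

lemma expectation_mult_le_sqrt_expectation_power2:
  fixes f g :: "'a \<Rightarrow> real"
  assumes "bounded (range f)" "\<And>x. \<bar>g x\<bar> \<le> 1"
  shows "measure_pmf.expectation p (\<lambda>x. f x * g x) \<le> sqrt (measure_pmf.expectation p (\<lambda>x. (f x)\<^sup>2))"
proof -
  have bounded_g: "bounded (range g)"
    using assms(2) by (intro boundedI[where B = 1]) auto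
  have "measure_pmf.expectation p (\<lambda>x. f x * g x) \<le> measure_pmf.expectation p (\<lambda>x. \<bar>f x\<bar>)"
  proof (intro integral_mono integrable_measure_pmf_bounded bounded_range_intros assms(1) bounded_g)
    show "f x * g x \<le> \<bar>f x\<bar>" for x
      using mult_mono[OF order_refl assms(2)[of x], of "\<bar>f x\<bar>"] abs_ge_self[of "f x * g x"]
      by (simp add: abs_mult)
  qed
  also have "\<dots> \<le> sqrt (measure_pmf.expectation p (\<lambda>x. (f x)\<^sup>2))"
  proof (rule real_le_rsqrt)
    have "measure_pmf.variance p (\<lambda>x. \<bar>f x\<bar>) =
        measure_pmf.expectation p (\<lambda>x. \<bar>f x\<bar>\<^sup>2) - (measure_pmf.expectation p (\<lambda>x. \<bar>f x\<bar>))\<^sup>2"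
      by (intro measure_pmf.variance_eq integrable_measure_pmf_bounded
          bounded_range_intros assms(1))
    then show "(measure_pmf.expectation p (\<lambda>x. \<bar>f x\<bar>))\<^sup>2 \<le> measure_pmf.expectation p (\<lambda>x. (f x)\<^sup>2)"
      using measure_pmf.variance_positive[of p "\<lambda>x. \<bar>f x\<bar>"] by simp
  qed
  finally show ?thesis .
qed

lemma expectation_sum_power2:
  fixes X :: "'i \<Rightarrow> 'a \<Rightarrow> real"
  assumes "finite K" "\<And>i. i \<in> K \<Longrightarrow> bounded (range (X i))"
  shows "measure_pmf.expectation p (\<lambda>x. (\<Sum>i\<in>K. X i x)\<^sup>2) =
    (\<Sum>i\<in>K. measure_pmf.expectation p (\<lambda>x. (X i x)\<^sup>2)) +
    (\<Sum>i\<in>K. \<Sum>j\<in>K - {i}. measure_pmf.expectation p (\<lambda>x. X i x * X j x))"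
proof -
  have integrable_product: "integrable (measure_pmf p) (\<lambda>x. X i x * X j x)"
    if "i \<in> K" "j \<in> K" for i j
    by (intro integrable_measure_pmf_bounded bounded_range_intros assms(2) that)
  have "measure_pmf.expectation p (\<lambda>x. (\<Sum>i\<in>K. X i x)\<^sup>2) =
      (\<Sum>i\<in>K. \<Sum>j\<in>K. measure_pmf.expectation p (\<lambda>x. X i x * X j x))"
    unfolding power2_eq_square sum_product
    by (simp add: Bochner_Integration.integral_sum integrable_product)
  also have "\<dots> = (\<Sum>i\<in>K. measure_pmf.expectation p (\<lambda>x. X i x * X i x) +
      (\<Sum>j\<in>K - {i}. measure_pmf.expectation p (\<lambda>x. X i x * X j x)))"
    using assms(1) by (intro sum.cong refl sum.remove)
  finally show ?thesis
    by (simp add: sum.distrib power2_eq_square)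
qed

section \<open>Independent Poisson variables\<close>

lemma expectation_Pi_pmf_component:
  fixes f :: "('i \<Rightarrow> 'b) \<Rightarrow> real"
  assumes "finite I" "i \<in> I" "bounded (range f)"
  shows "measure_pmf.expectation (Pi_pmf I d p) (\<lambda>x. of_bool (x i = y) * f x) =
    pmf (p i) y * measure_pmf.expectation (Pi_pmf (I - {i}) d p) (\<lambda>x. f (x(i := y)))"
proof -
  let ?rest = "Pi_pmf (I - {i}) d p"
  let ?g = "\<lambda>x. of_bool (x i = y) * f x"
  have "bounded (range ?g)"
    by (intro bounded_range_intros assms)
  then obtain B where abs_le_B: "\<And>x. \<bar>?g x\<bar> \<le> B"
    by (auto simp: bounded_real)
  have "Pi_pmf I d p = bind_pmf (p i) (\<lambda>z. map_pmf (\<lambda>x. x(i := z)) ?rest)"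
    using Pi_pmf_insert'[of "I - {i}" i d p] assms(1,2) by (simp add: insert_absorb map_pmf_def)
  then have "measure_pmf.expectation (Pi_pmf I d p) ?g =
      measure_pmf.expectation (p i)
        (\<lambda>z. measure_pmf.expectation (map_pmf (\<lambda>x. x(i := z)) ?rest) ?g)"
    by (simp only: measure_pmf_bind)
       (rule integral_bind[where K = "count_space UNIV" and B = B and B' = 1],
        use abs_le_B in \<open>auto intro: measure_pmf.finite_measure_axioms
          simp: space_subprob_algebra measure_pmf.subprob_space_axioms\<close>)
  also have "\<dots> = pmf (p i) y * measure_pmf.expectation ?rest (\<lambda>x. f (x(i := y)))"
    by (subst integral_measure_pmf_real[where A = "{y}"]) auto
  finally show ?thesis .
qed

lemma expectation_Pi_pmf_remove:
  fixes f :: "('i \<Rightarrow> 'b) \<Rightarrow> real"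
  assumes "finite I" "\<And>x z. f (x(i := z)) = f x"
  shows "measure_pmf.expectation (Pi_pmf (I - {i}) d p) f =
    measure_pmf.expectation (Pi_pmf I d p) f"
  using assms by (simp add: Pi_pmf_remove)

lemma pmf_pois_0: "r \<ge> 0 \<Longrightarrow> pmf (pois r) 0 = exp (- r)"
  by (simp add: pois_def)

lemma pmf_pois_1: "r \<ge> 0 \<Longrightarrow> pmf (pois r) 1 = r * exp (- r)"
  by (simp add: pois_def)

definition pois_prod :: "'i set \<Rightarrow> ('i \<Rightarrow> real) \<Rightarrow> ('i \<Rightarrow> nat) pmf" where
  "pois_prod I r = Pi_pmf I 0 (\<lambda>i. pois (r i))"

text \<open>Centred so as to be orthogonal to every bounded function that ignores the coordinate \<open>i\<close>.\<close>

definition compensated :: "('i \<Rightarrow> real) \<Rightarrow> 'i \<Rightarrow> ('i \<Rightarrow> nat) \<Rightarrow> real" where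
  "compensated r i L = of_bool (L i = 1) - r i * of_bool (L i = 0)"

definition add_point_diff :: "'i \<Rightarrow> (('i \<Rightarrow> nat) \<Rightarrow> real) \<Rightarrow> ('i \<Rightarrow> nat) \<Rightarrow> real" where
  "add_point_diff i f L = f (L(i := 1)) - f (L(i := 0))"

lemma bounded_range_compensated: "bounded (range (compensated r i))"
  unfolding compensated_def by (intro bounded_range_intros)

lemma bounded_range_add_point_diff:
  assumes "bounded (range f)"
  shows "bounded (range (add_point_diff i f))"
  unfolding add_point_diff_def by (intro bounded_minus_comp bounded_range_compose[OF assms])

lemma compensated_fun_upd: "i \<noteq> j \<Longrightarrow> compensated r i (L(j := n)) = compensated r i L"
  by (simp add: compensated_def)

lemma add_point_diff_compensated: "add_point_diff i (compensated r i) L = 1 + r i"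
  by (simp add: add_point_diff_def compensated_def)

lemma add_point_diff_eq_0: "(\<And>L n. f (L(i := n)) = f L) \<Longrightarrow> add_point_diff i f L = 0"
  by (simp add: add_point_diff_def)

locale poisson_family =
  fixes I :: "'i set" and r :: "'i \<Rightarrow> real"
  assumes finite_I: "finite I"
    and r_nonneg: "\<And>i. i \<in> I \<Longrightarrow> r i \<ge> 0"
begin

abbreviation expect :: "(('i \<Rightarrow> nat) \<Rightarrow> real) \<Rightarrow> real" where
  "expect \<equiv> measure_pmf.expectation (pois_prod I r)"

lemma expect_vacant_mult:
  assumes "K \<subseteq> I" "bounded (range f)"
    and f_upd: "\<And>i L n. i \<in> K \<Longrightarrow> f (L(i := n)) = f L"
  shows "expect (\<lambda>L. of_bool (\<forall>i\<in>K. L i = 0) * f L) = exp (- sum r K) * expect f"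
proof -
  have "finite K"
    using assms(1) finite_I finite_subset by blast
  then show ?thesis
    using assms(1) f_upd
  proof (induction K)
    case (insert i K)
    let ?g = "\<lambda>L. of_bool (\<forall>j\<in>K. L j = 0) * f L"
    have g_upd: "?g (L(i := n)) = ?g L" for L n
    proof -
      have "(\<forall>j\<in>K. (L(i := n)) j = 0) \<longleftrightarrow> (\<forall>j\<in>K. L j = 0)"
        using insert.hyps(2) by (intro ball_cong refl) (auto simp: fun_upd_def)
      then show ?thesis
        by (simp only: insert.prems(2)[OF insertI1])
    qed
    have bounded_g: "bounded (range ?g)"
      by (intro bounded_range_intros assms(2))
    have "expect (\<lambda>L. of_bool (\<forall>j\<in>insert i K. L j = 0) * f L) =
        expect (\<lambda>L. of_bool (L i = 0) * ?g L)"
      by (simp add: of_bool_conj mult.assoc)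
    also have "\<dots> = exp (- r i) *
        measure_pmf.expectation (pois_prod (I - {i}) r) (\<lambda>L. ?g (L(i := 0)))"
      using expectation_Pi_pmf_component[OF finite_I _ bounded_g, of i 0 "\<lambda>i. pois (r i)" 0]
        insert.prems(1) r_nonneg[of i]
      by (simp add: pois_prod_def pmf_pois_0)
    also have "\<dots> = exp (- r i) * expect ?g"
      using expectation_Pi_pmf_remove[where f = ?g and i = i, OF finite_I g_upd]
      unfolding pois_prod_def g_upd by simp
    also have "expect ?g = exp (- sum r K) * expect f"
      using insert.prems(1) by (intro insert.IH insert.prems(2)) auto
    finally show ?case
      using insert.hyps by (simp add: exp_add[symmetric])
  qed simp
qed

lemma expect_vacant: "K \<subseteq> I \<Longrightarrow> expect (\<lambda>L. of_bool (\<forall>i\<in>K. L i = 0)) = exp (- sum r K)"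
  using expect_vacant_mult[of K "\<lambda>_. 1"] by (simp add: bounded_range_const)

lemma expect_compensated_mult:
  assumes "i \<in> I" "bounded (range f)"
  shows "expect (\<lambda>L. compensated r i L * f L) =
    r i * expect (\<lambda>L. of_bool (L i = 0) * add_point_diff i f L)"
proof -
  let ?rest = "measure_pmf.expectation (pois_prod (I - {i}) r)"
  have integrable_f: "integrable (measure_pmf p) (\<lambda>L. of_bool (Q L) * f L)"
    "integrable (measure_pmf p) (\<lambda>L. f (g L))" for p Q g
    by (intro integrable_measure_pmf_bounded bounded_range_intros assms(2)
        bounded_range_compose[OF assms(2)])+
  have component:
    "expect (\<lambda>L. of_bool (L i = n) * g L) = pmf (pois (r i)) n * ?rest (\<lambda>L. g (L(i := n)))"
    if "bounded (range g)" for n g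
    unfolding pois_prod_def by (rule expectation_Pi_pmf_component[OF finite_I assms(1) that])
  have "expect (\<lambda>L. compensated r i L * f L) =
      expect (\<lambda>L. of_bool (L i = 1) * f L - r i * (of_bool (L i = 0) * f L))"
    by (simp add: compensated_def left_diff_distrib mult.assoc)
  also have "\<dots> = expect (\<lambda>L. of_bool (L i = 1) * f L) - r i * expect (\<lambda>L. of_bool (L i = 0) * f L)"
    using integrable_f by simp
  also have "\<dots> = r i * exp (- r i) * (?rest (\<lambda>L. f (L(i := 1))) - ?rest (\<lambda>L. f (L(i := 0))))"
    unfolding component[OF assms(2)]
    using r_nonneg[OF assms(1)] by (simp only: pmf_pois_0 pmf_pois_1) (simp add: algebra_simps)
  also have "\<dots> = r i * (pmf (pois (r i)) 0 * ?rest (\<lambda>L. add_point_diff i f (L(i := 0))))"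
    using integrable_f r_nonneg[OF assms(1)] by (simp add: add_point_diff_def pmf_pois_0)
  also have "\<dots> = r i * expect (\<lambda>L. of_bool (L i = 0) * add_point_diff i f L)"
    by (simp only: component[OF bounded_range_add_point_diff[OF assms(2)]])
  finally show ?thesis .
qed

lemma expect_compensated_power2_le:
  assumes "i \<in> I"
  shows "expect (\<lambda>L. (compensated r i L)\<^sup>2) \<le> r i"
proof -
  have "expect (\<lambda>L. (compensated r i L)\<^sup>2) =
      r i * ((1 + r i) * expect (\<lambda>L. of_bool (\<forall>j\<in>{i}. L j = 0)))"
    unfolding power2_eq_square expect_compensated_mult[OF assms bounded_range_compensated]
      add_point_diff_compensated
    by (simp add: mult.commute)
  also have "\<dots> = r i * ((1 + r i) * exp (- r i))"
    using assms by (subst expect_vacant) auto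
  also have "\<dots> \<le> r i * (exp (r i) * exp (- r i))"
    using r_nonneg[OF assms] exp_ge_add_one_self[of "r i"]
    by (intro mult_left_mono mult_right_mono) auto
  finally show ?thesis
    by (simp add: exp_minus)
qed

definition interaction :: "'i \<Rightarrow> 'i \<Rightarrow> (('i \<Rightarrow> nat) \<Rightarrow> real) \<Rightarrow> (('i \<Rightarrow> nat) \<Rightarrow> real) \<Rightarrow> real" where
  "interaction i j f g =
    expect (\<lambda>L. of_bool (L i = 0 \<and> L j = 0) * (add_point_diff j f L * add_point_diff i g L))"

lemma expect_compensated_pair:
  assumes "i \<in> I" "j \<in> I" "i \<noteq> j"
    and bounded: "bounded (range f)" "bounded (range g)"
    and f_upd: "\<And>L n. f (L(i := n)) = f L" and g_upd: "\<And>L n. g (L(j := n)) = g L"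
  shows "expect (\<lambda>L. (compensated r i L * f L) * (compensated r j L * g L)) =
    r i * (r j * interaction i j f g)"
proof -
  let ?fg = "\<lambda>L. of_bool (L i = 0) * f L * add_point_diff i g L"
  have "expect (\<lambda>L. (compensated r i L * f L) * (compensated r j L * g L)) =
      expect (\<lambda>L. compensated r i L * (f L * compensated r j L * g L))"
    by (simp add: mult_ac)
  also have "\<dots> = r i * expect (\<lambda>L. of_bool (L i = 0) *
      add_point_diff i (\<lambda>L. f L * compensated r j L * g L) L)"
    by (intro expect_compensated_mult assms bounded_range_intros bounded_range_compensated)
  also have "(\<lambda>L. of_bool (L i = 0) * add_point_diff i (\<lambda>L. f L * compensated r j L * g L) L) =
      (\<lambda>L. compensated r j L * ?fg L)"
    using \<open>i \<noteq> j\<close> by (simp add: add_point_diff_def f_upd compensated_fun_upd algebra_simps)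
  also have "expect (\<lambda>L. compensated r j L * ?fg L) =
      r j * expect (\<lambda>L. of_bool (L j = 0) * add_point_diff j ?fg L)"
    by (intro expect_compensated_mult assms bounded_range_intros bounded_range_add_point_diff)
  also have "(\<lambda>L. of_bool (L j = 0) * add_point_diff j ?fg L) =
      (\<lambda>L. of_bool (L i = 0 \<and> L j = 0) * (add_point_diff j f L * add_point_diff i g L))"
  proof
    fix L
    have "add_point_diff i g (L(j := n)) = add_point_diff i g L" for n
      using \<open>i \<noteq> j\<close> by (simp add: add_point_diff_def fun_upd_twist[of j i] g_upd del: One_nat_def)
    then show "of_bool (L j = 0) * add_point_diff j ?fg L =
        of_bool (L i = 0 \<and> L j = 0) * (add_point_diff j f L * add_point_diff i g L)"
      using \<open>i \<noteq> j\<close> by (simp add: add_point_diff_def[of j] algebra_simps)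
  qed
  finally show ?thesis
    by (simp add: interaction_def)
qed

text \<open>The second moment of a Skorokhod integral: interactions replace the covariances
  that vanish for deterministic integrands.\<close>

lemma expect_sum_compensated_mult_power2_le:
  assumes "K \<subseteq> I"
    and s_upd: "\<And>i L n. i \<in> K \<Longrightarrow> s i (L(i := n)) = s i L"
    and s_le: "\<And>i L. \<bar>s i L\<bar> \<le> 1"
  shows "expect (\<lambda>L. (\<Sum>i\<in>K. compensated r i L * s i L)\<^sup>2) \<le>
    sum r K + (\<Sum>i\<in>K. \<Sum>j\<in>K - {i}. r i * (r j * interaction i j (s i) (s j)))"
proof -
  have finite_K: "finite K"
    using assms(1) finite_I finite_subset by blast
  have bounded_s: "bounded (range (s i))" for i
    using s_le by (intro boundedI[where B = 1]) auto
  have diagonal: "expect (\<lambda>L. (compensated r i L * s i L)\<^sup>2) \<le> r i" if "i \<in> K" for i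
  proof -
    have "expect (\<lambda>L. (compensated r i L * s i L)\<^sup>2) \<le> expect (\<lambda>L. (compensated r i L)\<^sup>2)"
    proof (intro integral_mono integrable_measure_pmf_bounded bounded_range_intros
        bounded_range_compensated bounded_s)
      show "(compensated r i L * s i L)\<^sup>2 \<le> (compensated r i L)\<^sup>2" for L
        using s_le[of i L] by (simp add: power_mult_distrib mult_left_le abs_square_le_1)
    qed
    also have "\<dots> \<le> r i"
      using that assms(1) by (intro expect_compensated_power2_le) auto
    finally show ?thesis .
  qed
  have "expect (\<lambda>L. (\<Sum>i\<in>K. compensated r i L * s i L)\<^sup>2) =
      (\<Sum>i\<in>K. expect (\<lambda>L. (compensated r i L * s i L)\<^sup>2)) +
      (\<Sum>i\<in>K. \<Sum>j\<in>K - {i}. expect (\<lambda>L. (compensated r i L * s i L) * (compensated r j L * s j L)))"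
    by (intro expectation_sum_power2 finite_K bounded_range_intros
        bounded_range_compensated bounded_s)
  also have "\<dots> \<le> sum r K + (\<Sum>i\<in>K. \<Sum>j\<in>K - {i}. r i * (r j * interaction i j (s i) (s j)))"
    using assms(1) diagonal
    by (intro add_mono sum_mono eq_refl[OF expect_compensated_pair] bounded_s s_upd) auto
  finally show ?thesis .
qed

lemma expect_sum_compensated_power2_le:
  assumes "K \<subseteq> I"
  shows "expect (\<lambda>L. (\<Sum>i\<in>K. compensated r i L)\<^sup>2) \<le> sum r K"
  using expect_sum_compensated_mult_power2_le[of K "\<lambda>_ _. 1"] assms
  by (simp add: interaction_def add_point_diff_eq_0)

end

section \<open>Closures under random firing rules\<close>

definition fire_closed :: "('i \<Rightarrow> 'v set \<Rightarrow> 'v \<Rightarrow> bool) \<Rightarrow> 'i set \<Rightarrow> 'v set \<Rightarrow> 'v set \<Rightarrow> bool" where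
  "fire_closed R act U S \<longleftrightarrow> S \<subseteq> U \<and> (\<forall>i\<in>act. \<forall>v\<in>U - S. \<not> R i S v)"

definition fire_closure :: "('i \<Rightarrow> 'v set \<Rightarrow> 'v \<Rightarrow> bool) \<Rightarrow> 'i set \<Rightarrow> 'v set \<Rightarrow> 'v set" where
  "fire_closure R act U = \<Inter> {S. fire_closed R act U S}"

definition active :: "'i set \<Rightarrow> ('i \<Rightarrow> nat) \<Rightarrow> 'i set" where
  "active I L = {i \<in> I. L i > 0}"

lemma fire_closed_self: "fire_closed R act U U"
  by (simp add: fire_closed_def)

lemma fire_closure_least: "fire_closed R act U S \<Longrightarrow> fire_closure R act U \<subseteq> S"
  by (auto simp: fire_closure_def)

lemma fire_closure_subset: "fire_closure R act U \<subseteq> U"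
  by (rule fire_closure_least[OF fire_closed_self])

locale firing_rule =
  fixes R :: "'i \<Rightarrow> 'v set \<Rightarrow> 'v \<Rightarrow> bool" and V :: "'v set"
  assumes finite_V: "finite V"
    and R_mono: "\<And>i S T v. R i S v \<Longrightarrow> S \<subseteq> T \<Longrightarrow> T \<subseteq> V \<Longrightarrow> v \<notin> T \<Longrightarrow> R i T v"
begin

lemma fire_closed_fire_closure:
  assumes "U \<subseteq> V"
  shows "fire_closed R act U (fire_closure R act U)"
  unfolding fire_closed_def
proof (intro conjI ballI notI fire_closure_subset)
  fix i v assume "i \<in> act" and "v \<in> U - fire_closure R act U"
    and fires: "R i (fire_closure R act U) v"
  then obtain S where S: "fire_closed R act U S" "v \<notin> S"
    by (auto simp: fire_closure_def)
  then have "R i S v"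
    using assms by (intro R_mono[OF fires] fire_closure_least) (auto simp: fire_closed_def)
  then show False
    using S \<open>i \<in> act\<close> \<open>v \<in> U - fire_closure R act U\<close> by (auto simp: fire_closed_def)
qed

lemma fire_closure_eqI:
  assumes "U \<subseteq> V" "fire_closed R act U S" "\<And>T. fire_closed R act U T \<Longrightarrow> T \<subseteq> S \<Longrightarrow> S \<subseteq> T"
  shows "fire_closure R act U = S"
  using assms fire_closed_fire_closure fire_closure_least by (meson subset_antisym)

lemma fire_closed_superset:
  assumes "S \<subseteq> U" "U \<subseteq> V" "fire_closed R act U S" "fire_closed R act S T"
  shows "fire_closed R act U T"
  unfolding fire_closed_def
proof (intro conjI ballI notI)
  show "T \<subseteq> U"
    using assms by (auto simp: fire_closed_def)
  fix i v assume fires: "i \<in> act" "v \<in> U - T" "R i T v"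
  show False
  proof (cases "v \<in> S")
    case True
    then show ?thesis
      using fires assms(4) by (auto simp: fire_closed_def)
  next
    case False
    then have "R i S v"
      using assms by (intro R_mono[OF fires(3)]) (auto simp: fire_closed_def)
    then show ?thesis
      using fires assms(3) False by (auto simp: fire_closed_def)
  qed
qed

text \<open>Restricting the vertex set to \<open>S\<close> separates what happens inside \<open>S\<close> from
  the event that nothing fires out of \<open>S\<close>.\<close>

lemma fire_closure_eq_iff:
  assumes "S \<subseteq> U" "U \<subseteq> V"
  shows "fire_closure R act U = S \<longleftrightarrow>
    fire_closure R act S = S \<and> (\<forall>i\<in>act. \<forall>v\<in>U - S. \<not> R i S v)"
proof
  assume closure_eq: "fire_closure R act U = S"
  then have closed: "fire_closed R act U S"
    using fire_closed_fire_closure assms by blast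
  have "fire_closure R act S = S"
  proof (rule fire_closure_eqI)
    show "S \<subseteq> T" if "fire_closed R act S T" for T
      using fire_closure_least[OF fire_closed_superset[OF assms closed that]] closure_eq by simp
  qed (use assms in \<open>auto simp: fire_closed_self\<close>)
  then show "fire_closure R act S = S \<and> (\<forall>i\<in>act. \<forall>v\<in>U - S. \<not> R i S v)"
    using closed by (auto simp: fire_closed_def)
next
  assume inner: "fire_closure R act S = S \<and> (\<forall>i\<in>act. \<forall>v\<in>U - S. \<not> R i S v)"
  show "fire_closure R act U = S"
  proof (rule fire_closure_eqI)
    fix T assume "fire_closed R act U T" "T \<subseteq> S"
    then have "fire_closed R act S T"
      using assms by (auto simp: fire_closed_def)
    then show "S \<subseteq> T"
      using inner fire_closure_least by blast
  qed (use inner assms in \<open>auto simp: fire_closed_def\<close>)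
qed

end

definition escaping :: "('i \<Rightarrow> 'v set \<Rightarrow> 'v \<Rightarrow> bool) \<Rightarrow> 'i set \<Rightarrow> 'v set \<Rightarrow> 'v set \<Rightarrow> 'i set" where
  "escaping R I S U = {i \<in> I. \<exists>v\<in>U - S. R i S v}"

text \<open>A rule that fires from within \<open>S\<close> onto a vertex of \<open>S\<close> cannot later fire out of \<open>S\<close>, so
  the two events of \<open>fire_closure_eq_iff\<close> depend on disjoint sets of variables.\<close>

locale random_firing = firing_rule R V + poisson_family I r
  for R :: "'i \<Rightarrow> 'v set \<Rightarrow> 'v \<Rightarrow> bool" and V and I :: "'i set" and r +
  assumes R_inner_outer: "\<And>i S T v w. R i T v \<Longrightarrow> T \<subseteq> S \<Longrightarrow> v \<in> S - T \<Longrightarrow> w \<notin> S \<Longrightarrow> \<not> R i S w"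
begin

definition closure_prob :: "'v set \<Rightarrow> 'v set \<Rightarrow> real" where
  "closure_prob U S = measure_pmf.prob (pois_prod I r) {L. fire_closure R (active I L) U = S}"

lemma fire_closure_fun_upd_escaping:
  assumes "i \<in> escaping R I S U"
  shows "fire_closure R (active I (L(i := n))) S = fire_closure R (active I L) S"
proof -
  have "\<not> R i T v" if "T \<subseteq> S" "v \<in> S - T" for T v
    using assms R_inner_outer[of i T v S] that by (auto simp: escaping_def)
  then have "fire_closed R (active I (L(i := n))) S T \<longleftrightarrow> fire_closed R (active I L) S T" for T
    by (auto simp: fire_closed_def active_def)
  then show ?thesis
    by (simp add: fire_closure_def)
qed

lemma closure_prob_factor:
  assumes "S \<subseteq> U" "U \<subseteq> V"
  shows "closure_prob U S = exp (- sum r (escaping R I S U)) * closure_prob S S"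
proof -
  have "closure_prob U S = expect (\<lambda>L. of_bool (\<forall>i\<in>escaping R I S U. L i = 0) *
      of_bool (fire_closure R (active I L) S = S))"
    unfolding closure_prob_def fire_closure_eq_iff[OF assms] expectation_of_bool[symmetric]
      of_bool_conj[symmetric]
    by (intro arg_cong[where f = expect] ext arg_cong[where f = of_bool])
       (auto simp: escaping_def active_def)
  also have "\<dots> = exp (- sum r (escaping R I S U)) *
      expect (\<lambda>L. of_bool (fire_closure R (active I L) S = S))"
  proof (rule expect_vacant_mult)
    show "escaping R I S U \<subseteq> I"
      by (auto simp: escaping_def)
    show "of_bool (fire_closure R (active I (L(i := n))) S = S) =
        of_bool (fire_closure R (active I L) S = S)" if "i \<in> escaping R I S U" for i L n
      by (simp only: fire_closure_fun_upd_escaping[OF that])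
  qed (rule bounded_range_of_bool)
  finally show ?thesis
    unfolding closure_prob_def expectation_of_bool .
qed

lemma prob_fire_closure:
  assumes "U \<subseteq> V"
  shows "measure_pmf.prob (pois_prod I r) {L. Q (fire_closure R (active I L) U)} =
    (\<Sum>S | S \<subseteq> U \<and> Q S. closure_prob U S)"
proof -
  have "{L. Q (fire_closure R (active I L) U)} =
      (\<Union>S\<in>{S. S \<subseteq> U \<and> Q S}. {L. fire_closure R (active I L) U = S})"
    using fire_closure_subset[of R _ U] by blast
  moreover have "finite {S. S \<subseteq> U \<and> Q S}"
    using finite_subset[OF assms finite_V] by simp
  ultimately show ?thesis
    unfolding closure_prob_def
    by (simp only:)
       (rule measure_pmf.finite_measure_finite_Union, auto simp: disjoint_family_on_def)
qed

lemma closure_prob_full: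
  assumes "U \<subseteq> V"
  shows "closure_prob U U =
    1 - (\<Sum>S\<in>Pow U - {U}. exp (- sum r (escaping R I S U)) * closure_prob S S)"
proof -
  have "finite (Pow U)"
    using finite_subset[OF assms finite_V] by simp
  then have "1 = closure_prob U U + (\<Sum>S\<in>Pow U - {U}. closure_prob U S)"
    using prob_fire_closure[OF assms, of "\<lambda>_. True"] by (simp add: Pow_def sum.remove[of _ U])
  also have "(\<Sum>S\<in>Pow U - {U}. closure_prob U S) =
      (\<Sum>S\<in>Pow U - {U}. exp (- sum r (escaping R I S U)) * closure_prob S S)"
    using assms by (intro sum.cong refl closure_prob_factor) auto
  finally show ?thesis
    by simp
qed

end

theorem random_firing_law_unique:
  assumes "random_firing R V I r" "random_firing R' V I' r'"
    and rates: "\<And>S U. S \<subseteq> U \<Longrightarrow> U \<subseteq> V \<Longrightarrow> sum r (escaping R I S U) = sum r' (escaping R' I' S U)"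
  shows "measure_pmf.prob (pois_prod I r) {L. Q (fire_closure R (active I L) V)} =
    measure_pmf.prob (pois_prod I' r') {L. Q (fire_closure R' (active I' L) V)}"
proof -
  interpret first: random_firing R V I r by fact
  interpret second: random_firing R' V I' r' by fact
  have full: "first.closure_prob U U = second.closure_prob U U" if "U \<subseteq> V" for U
    using finite_subset[OF that first.finite_V] that
  proof (induction U rule: finite_psubset_induct)
    case (psubset U)
    have "first.closure_prob S S = second.closure_prob S S" if "S \<in> Pow U - {U}" for S
      using that psubset.prems by (intro psubset.IH) auto
    then show ?case
      using psubset.prems by (simp add: first.closure_prob_full second.closure_prob_full rates)
  qed
  have "first.closure_prob V S = second.closure_prob V S" if "S \<subseteq> V" for S
    using that
    by (simp add: first.closure_prob_factor[of S V] second.closure_prob_factor[of S V] full rates)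
  then show ?thesis
    unfolding first.prob_fire_closure[OF subset_refl] second.prob_fire_closure[OF subset_refl]
    by (intro sum.cong refl) simp
qed

section \<open>Threshold systems\<close>

text \<open>A vertex \<open>v\<close> with \<open>L (v, j) > 0\<close> joins as soon as \<open>j\<close> vertices are
  present: the smallest such \<open>j\<close> is the threshold of \<open>v\<close> in Sellke's construction.\<close>

definition threshold_fires :: "'v \<times> nat \<Rightarrow> 'v set \<Rightarrow> 'v \<Rightarrow> bool" where
  "threshold_fires p S v \<longleftrightarrow> fst p = v \<and> snd p \<le> card S"

definition threshold_rate :: "(nat \<Rightarrow> real) \<Rightarrow> 'v \<times> nat \<Rightarrow> real" where
  "threshold_rate h p = (if snd p = 0 then h 0 else h (snd p) - h (snd p - 1))"

lemma sum_threshold_rate: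
  "(\<Sum>p\<in>W \<times> {..n}. threshold_rate h p) = real (card W) * h n"
proof -
  have "(\<Sum>j\<le>n. threshold_rate h (v, j)) = h n" for v :: 'a
    by (induction n) (auto simp: threshold_rate_def)
  moreover have "(\<Sum>p\<in>W \<times> {..n}. threshold_rate h p) = (\<Sum>v\<in>W. \<Sum>j\<le>n. threshold_rate h (v, j))"
    by (simp add: sum.cartesian_product)
  ultimately show ?thesis
    by simp
qed

definition reached :: "'v set \<Rightarrow> ('v \<times> nat \<Rightarrow> nat) \<Rightarrow> nat \<Rightarrow> 'v set" where
  "reached V L n = {v \<in> V. \<exists>j\<le>n. L (v, j) > 0}"

lemma reached_subset: "reached V L n \<subseteq> V"
  by (auto simp: reached_def)

lemma reached_mono: "m \<le> n \<Longrightarrow> reached V L m \<subseteq> reached V L n"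
  unfolding reached_def using order_trans by fast

definition threshold_closure :: "'v set \<Rightarrow> ('v \<times> nat \<Rightarrow> nat) \<Rightarrow> 'v set" where
  "threshold_closure V L = fire_closure threshold_fires (active (V \<times> {..card V}) L) V"

definition threshold_law :: "'v set \<Rightarrow> (nat \<Rightarrow> real) \<Rightarrow> ('v \<times> nat \<Rightarrow> nat) pmf" where
  "threshold_law V h = pois_prod (V \<times> {..card V}) (threshold_rate h)"

locale threshold_system =
  fixes V :: "'v set" and h :: "nat \<Rightarrow> real"
  assumes finite_V: "finite V" and h_0_nonneg: "h 0 \<ge> 0" and mono_h: "mono h"
begin

lemma h_nonneg: "h n \<ge> 0"
  using h_0_nonneg monoD[OF mono_h, of 0 n] by simp

sublocale random_firing threshold_fires V "V \<times> {..card V}" "threshold_rate h"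
proof
  show "threshold_fires i T v"
    if "threshold_fires i S v" "S \<subseteq> T" "T \<subseteq> V" "v \<notin> T" for i S T and v :: 'v
    using that card_mono[of T S] finite_subset[OF that(3) finite_V]
    by (auto simp: threshold_fires_def)
  show "threshold_rate h p \<ge> 0" for p :: "'v \<times> nat"
    using h_0_nonneg monoD[OF mono_h, of "snd p - 1" "snd p"] by (auto simp: threshold_rate_def)
qed (auto simp: finite_V threshold_fires_def)

lemma sum_threshold_rate_escaping:
  assumes "S \<subseteq> U" "U \<subseteq> V"
  shows "sum (threshold_rate h) (escaping threshold_fires (V \<times> {..card V}) S U) =
    real (card (U - S)) * h (card S)"
proof -
  have "card S \<le> card V"
    using assms finite_V by (intro card_mono) auto
  then have "escaping threshold_fires (V \<times> {..card V}) S U = (U - S) \<times> {..card S}"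
    using assms by (auto simp: escaping_def threshold_fires_def)
  then show ?thesis
    by (simp add: sum_threshold_rate)
qed

lemma fire_closed_threshold_iff:
  assumes "S \<subseteq> V"
  shows "fire_closed threshold_fires (active (V \<times> {..card V}) L) V S \<longleftrightarrow> reached V L (card S) \<subseteq> S"
proof
  assume closed: "fire_closed threshold_fires (active (V \<times> {..card V}) L) V S"
  show "reached V L (card S) \<subseteq> S"
  proof
    fix v assume "v \<in> reached V L (card S)"
    then obtain j where j: "v \<in> V" "j \<le> card S" "L (v, j) > 0"
      by (auto simp: reached_def)
    moreover have "card S \<le> card V"
      using assms finite_V by (intro card_mono) auto
    ultimately have "(v, j) \<in> active (V \<times> {..card V}) L"
      by (simp add: active_def)
    then show "v \<in> S"
      using closed j by (force simp: fire_closed_def threshold_fires_def)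
  qed
next
  assume "reached V L (card S) \<subseteq> S"
  then show "fire_closed threshold_fires (active (V \<times> {..card V}) L) V S"
    using assms by (auto simp: fire_closed_def active_def threshold_fires_def reached_def)
qed

lemma card_reached_threshold_closure:
  "card (reached V L (card (threshold_closure V L))) \<le> card (threshold_closure V L)"
proof (rule card_mono)
  have sub: "threshold_closure V L \<subseteq> V"
    unfolding threshold_closure_def by (rule fire_closure_subset)
  then show "finite (threshold_closure V L)"
    using finite_V by (rule finite_subset)
  have "fire_closed threshold_fires (active (V \<times> {..card V}) L) V (threshold_closure V L)"
    unfolding threshold_closure_def by (rule fire_closed_fire_closure) simp
  then show "reached V L (card (threshold_closure V L)) \<subseteq> threshold_closure V L"
    by (simp add: fire_closed_threshold_iff[OF sub])
qed

lemma card_threshold_closure_le: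
  assumes "n \<le> card V" "card (reached V L n) \<le> n"
  shows "card (threshold_closure V L) \<le> n"
proof -
  obtain S where S: "reached V L n \<subseteq> S" "S \<subseteq> V" "card S = n"
    using exists_subset_between[OF assms(2,1) reached_subset finite_V] by metis
  then have "threshold_closure V L \<subseteq> S"
    unfolding threshold_closure_def
    by (intro fire_closure_least) (simp add: fire_closed_threshold_iff)
  then show ?thesis
    using S finite_V by (metis card_mono finite_subset)
qed

lemma expect_unreached:
  assumes "W \<subseteq> V" "n \<le> card V"
  shows "expect (\<lambda>L. of_bool (W \<inter> reached V L n = {})) = exp (- h n) ^ card W"
proof -
  have "W \<inter> reached V L n = {} \<longleftrightarrow> (\<forall>p\<in>W \<times> {..n}. L p = 0)" for L
    using assms(1) by (auto simp: reached_def)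
  moreover have "expect (\<lambda>L. of_bool (\<forall>p\<in>W \<times> {..n}. L p = 0)) = exp (- (real (card W) * h n))"
    unfolding sum_threshold_rate[symmetric] using assms by (intro expect_vacant) auto
  ultimately show ?thesis
    by (simp add: exp_of_nat_mult[symmetric])
qed

lemma expect_unreached_covariance:
  assumes "v \<in> V" "w \<in> V" "v \<noteq> w" "n \<le> card V"
  shows "expect (\<lambda>L. (of_bool (v \<notin> reached V L n) - exp (- h n)) *
    (of_bool (w \<notin> reached V L n) - exp (- h n))) = 0"
proof -
  define q where "q = exp (- h n)"
  define unreached :: "'v set \<Rightarrow> _ \<Rightarrow> real"
    where "unreached W L = of_bool (W \<inter> reached V L n = {})" for W L
  have integrable_unreached: "integrable (measure_pmf p) (unreached W)" for p W
    unfolding unreached_def by (intro integrable_measure_pmf_bounded bounded_range_intros)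
  have expect_eq: "expect (unreached W) = q ^ card W" if "W \<subseteq> V" for W
    unfolding unreached_def q_def using that assms(4) by (rule expect_unreached)
  have "(of_bool (v \<notin> reached V L n) - q) * (of_bool (w \<notin> reached V L n) - q) =
      unreached {v, w} L - q * unreached {v} L - q * unreached {w} L + q\<^sup>2" for L
    by (simp add: unreached_def algebra_simps power2_eq_square)
  then have "expect (\<lambda>L. (of_bool (v \<notin> reached V L n) - q) * (of_bool (w \<notin> reached V L n) - q)) =
      expect (unreached {v, w}) - q * expect (unreached {v}) - q * expect (unreached {w}) + q\<^sup>2"
    using integrable_unreached by simp
  also have "\<dots> = 0"
    using assms by (simp add: expect_eq power2_eq_square)
  finally show ?thesis
    by (simp add: q_def)
qed

lemma expect_card_reached_deviation_le:
  assumes "n \<le> card V"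
  shows "expect (\<lambda>L. (real (card (reached V L n)) - real (card V) * (1 - exp (- h n)))\<^sup>2) \<le>
    real (card V)"
proof -
  define Z where "Z v L = of_bool (v \<notin> reached V L n) - exp (- h n)" for v L
  have bounded_Z: "bounded (range (Z v))" for v
    unfolding Z_def by (intro bounded_range_intros)
  have "expect (\<lambda>L. (Z v L)\<^sup>2) \<le> expect (\<lambda>_. 1)" for v
  proof (intro integral_mono integrable_measure_pmf_bounded bounded_range_intros bounded_Z)
    show "(Z v L)\<^sup>2 \<le> 1" for L
      using h_nonneg[of n] by (auto simp: Z_def abs_square_le_1)
  qed
  moreover have "expect (\<lambda>L. Z v L * Z w L) = 0" if "v \<in> V" "w \<in> V - {v}" for v w
    unfolding Z_def using that assms by (intro expect_unreached_covariance) auto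
  ultimately have "expect (\<lambda>L. (\<Sum>v\<in>V. Z v L)\<^sup>2) \<le> real (card V)"
    using sum_mono[of V "\<lambda>v. expect (\<lambda>L. (Z v L)\<^sup>2)" "\<lambda>_. 1"]
    by (subst expectation_sum_power2) (simp_all add: finite_V bounded_Z)
  moreover have
    "real (card (reached V L n)) - real (card V) * (1 - exp (- h n)) = - (\<Sum>v\<in>V. Z v L)" for L
  proof -
    have "(\<Sum>v\<in>V. of_bool (v \<notin> reached V L n)) = real (card (V - reached V L n))"
      using finite_V by (simp add: of_bool_def sum.If_cases Diff_eq Compl_eq)
    also have "\<dots> = real (card V) - real (card (reached V L n))"
      using finite_V card_mono[OF finite_V reached_subset[of V L n]] reached_subset[of V L n]
      by (subst card_Diff_subset) (auto intro: finite_subset)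
    finally show ?thesis
      by (simp add: Z_def sum_subtractf algebra_simps)
  qed
  ultimately show ?thesis
    by simp
qed

end

section \<open>Hypergraph closures and identifiable vertices\<close>

definition edge_sets :: "'v set \<Rightarrow> 'v set set" where
  "edge_sets V = Pow V - {{}}"

definition edge_fires :: "'v set \<Rightarrow> 'v set \<Rightarrow> 'v \<Rightarrow> bool" where
  "edge_fires A S v \<longleftrightarrow> A - S = {v}"

definition patch_closure :: "'v set \<Rightarrow> ('v set \<Rightarrow> nat) \<Rightarrow> 'v set" where
  "patch_closure V L = fire_closure edge_fires (active (edge_sets V) L) V"

lemma finite_edge_sets: "finite V \<Longrightarrow> finite (edge_sets V)"
  by (simp add: edge_sets_def)

lemma edge_sets_imp_subset: "A \<in> edge_sets V \<Longrightarrow> A \<subseteq> V"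
  by (simp add: edge_sets_def)

lemma card_edge_set:
  assumes "finite V" "A \<in> edge_sets V"
  shows "1 \<le> card A" "card A \<le> card V"
  using assms card_mono[OF assms(1)] finite_subset[OF edge_sets_imp_subset[OF assms(2)] assms(1)]
  by (auto simp: edge_sets_def Suc_le_eq card_gt_0_iff)

lemma firing_rule_edge_fires: "finite V \<Longrightarrow> firing_rule edge_fires V"
  by unfold_locales (auto simp: edge_fires_def)

lemma fire_closed_edge_iff:
  "fire_closed edge_fires (active (edge_sets V) L) V S \<longleftrightarrow>
    S \<subseteq> V \<and> (\<forall>A\<in>edge_sets V. L A > 0 \<longrightarrow> card (A - S) \<noteq> 1)"
proof -
  have "(\<exists>v\<in>V - S. edge_fires A S v) \<longleftrightarrow> card (A - S) = 1" if "A \<in> edge_sets V" for A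
    using that by (auto simp: edge_fires_def card_1_singleton_iff edge_sets_def)
  then show ?thesis
    unfolding fire_closed_def active_def by auto
qed

lemma patch_closure_subset: "patch_closure V L \<subseteq> V"
  unfolding patch_closure_def by (rule fire_closure_subset)

lemma patch_closure_closed:
  assumes "finite V" "A \<in> edge_sets V" "L A > 0"
  shows "card (A - patch_closure V L) \<noteq> 1"
  using firing_rule.fire_closed_fire_closure[OF firing_rule_edge_fires[OF assms(1)] subset_refl,
      of "active (edge_sets V) L"] assms(2,3)
  unfolding patch_closure_def[symmetric] fire_closed_edge_iff by blast

lemma patch_closure_least:
  assumes "S \<subseteq> V" "\<And>A. A \<in> edge_sets V \<Longrightarrow> L A > 0 \<Longrightarrow> card (A - S) \<noteq> 1"
  shows "patch_closure V L \<subseteq> S"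
  unfolding patch_closure_def using assms
  by (intro fire_closure_least) (simp add: fire_closed_edge_iff)

lemma patch_closure_mono:
  assumes "finite V" "\<And>A. L A > 0 \<Longrightarrow> L' A > 0"
  shows "patch_closure V L \<subseteq> patch_closure V L'"
  using assms patch_closure_closed by (intro patch_closure_least patch_closure_subset) blast

lemma patch_closure_cong:
  assumes "finite V" "\<And>A. L A > 0 \<longleftrightarrow> L' A > 0"
  shows "patch_closure V L = patch_closure V L'"
  using assms by (intro subset_antisym patch_closure_mono) auto

lemma edges_mset_iff: "B \<in># edges_mset N L \<longleftrightarrow> B \<subseteq> {..<N} \<and> L B > 0"
  by (auto simp: edges_mset_def set_mset_sum)

text \<open>After removal of \<open>S\<close> the remaining hyperedges are the traces \<open>B - S\<close> of the original ones.\<close>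

definition collapsed_state :: "nat \<Rightarrow> (nat set \<Rightarrow> nat) \<Rightarrow> nat set multiset \<times> nat set \<Rightarrow> bool" where
  "collapsed_state N L = (\<lambda>(H, S). (\<forall>C\<in>#H. \<exists>B\<in>#edges_mset N L. C = B - S) \<and>
    (\<forall>B\<in>#edges_mset N L. B \<subseteq> S \<or> B - S \<in># H) \<and> S \<subseteq> patch_closure {..<N} L)"

lemma collapsed_stateD:
  assumes "collapsed_state N L (H, S)"
  shows "C \<in># H \<Longrightarrow> \<exists>B. B \<in># edges_mset N L \<and> C = B - S"
    and "B \<in># edges_mset N L \<Longrightarrow> B \<subseteq> S \<or> B - S \<in># H"
    and "S \<subseteq> patch_closure {..<N} L"
  using assms unfolding collapsed_state_def by blast+

lemma patch_mem_patch_closure: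
  assumes "collapsed_state N L (H, S)" "{v} \<in># H"
  shows "v \<in> patch_closure {..<N} L"
proof (rule ccontr)
  assume v: "v \<notin> patch_closure {..<N} L"
  obtain B where B: "B \<in># edges_mset N L" "{v} = B - S"
    using collapsed_stateD(1)[OF assms] by blast
  then have "B - patch_closure {..<N} L = {v}"
    using v collapsed_stateD(3)[OF assms(1)] by blast
  moreover have "B \<in> edge_sets {..<N}" "L B > 0"
    using B by (auto simp: edges_mset_iff edge_sets_def)
  ultimately show False
    using patch_closure_closed[of "{..<N}" B L] by simp
qed

lemma collapsed_state_step:
  assumes "ident_step (H, S) (H', S')" "collapsed_state N L (H, S)"
  shows "collapsed_state N L (H', S')"
proof -
  note state = collapsed_stateD[OF assms(2)]
  obtain v where v: "{v} \<in># H" "H' = image_mset (\<lambda>B. B - {v}) (H - {#{v}#})" "S' = insert v S"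
    using assms(1) by (auto elim: ident_step.cases)
  have "\<exists>B\<in>#edges_mset N L. C = B - S'" if C: "C \<in># H'" for C
  proof -
    obtain D where D: "D \<in># H" "C = D - {v}"
      using C by (auto simp: v(2) dest: in_diffD)
    then obtain B where "B \<in># edges_mset N L" "D = B - S"
      using state(1) by blast
    then show ?thesis
      using D v(3) by (intro bexI[of _ B]) auto
  qed
  moreover have "B - S' \<in># H'" if "B \<in># edges_mset N L" "\<not> B \<subseteq> S'" for B
  proof -
    have "B - S \<in># H" "B - S \<noteq> {v}"
      using state(2)[OF that(1)] that(2) v(3) by auto
    then have "B - S \<in># H - {#{v}#}"
      by (simp add: in_diff_count)
    moreover have "B - S' = (B - S) - {v}"
      using v(3) by auto
    ultimately show ?thesis
      unfolding v(2) by auto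
  qed
  moreover have "S' \<subseteq> patch_closure {..<N} L"
    using patch_mem_patch_closure[OF assms(2) v(1)] state(3) v(3) by simp
  ultimately show ?thesis
    by (auto simp: collapsed_state_def)
qed

lemma collapsed_state_reachable:
  assumes "ident_step\<^sup>*\<^sup>* (edges_mset N L, {}) st"
  shows "collapsed_state N L st"
  using assms
proof (induction rule: rtranclp_induct)
  case base
  then show ?case
    by (auto simp: collapsed_state_def)
next
  case (step st st')
  then show ?case
    using collapsed_state_step[of "fst st" "snd st" "fst st'" "snd st'"] by simp
qed

lemma ident_step_terminates:
  "\<exists>H' S'. ident_step\<^sup>*\<^sup>* (H, S) (H', S') \<and> ident_terminal (H', S')"
proof (induction "size H" arbitrary: H S rule: less_induct)
  case less
  show ?case
  proof (cases "ident_terminal (H, S)")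
    case False
    then obtain v where v: "{v} \<in># H"
      by (auto simp: ident_terminal_def)
    let ?H = "image_mset (\<lambda>B. B - {v}) (H - {#{v}#})"
    have "size ?H < size H"
      using size_Diff1_less[OF v] by simp
    from less[OF this, of "insert v S"] show ?thesis
      using ident_step.intros[OF v, of S] by (meson converse_rtranclp_into_rtranclp)
  qed auto
qed

lemma terminal_eq_patch_closure:
  assumes "ident_step\<^sup>*\<^sup>* (edges_mset N L, {}) (H, S)" "ident_terminal (H, S)"
  shows "S = patch_closure {..<N} L"
proof
  note state = collapsed_stateD[OF collapsed_state_reachable[OF assms(1)]]
  show "S \<subseteq> patch_closure {..<N} L"
    by (rule state(3))
  show "patch_closure {..<N} L \<subseteq> S"
  proof (rule patch_closure_least)
    show "S \<subseteq> {..<N}"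
      using state(3) patch_closure_subset by (rule subset_trans)
    fix A assume A: "A \<in> edge_sets {..<N}" "L A > 0"
    show "card (A - S) \<noteq> 1"
    proof
      assume "card (A - S) = 1"
      then obtain v where "A - S = {v}"
        by (auto simp: card_1_singleton_iff)
      then have "{v} \<in># H"
        using state(2)[of A] A by (auto simp: edges_mset_iff edge_sets_def)
      then show False
        using assms(2) by (auto simp: ident_terminal_def)
    qed
  qed
qed

lemma identifiable_eq_patch_closure: "identifiable N L = patch_closure {..<N} L"
  unfolding identifiable_def
proof (rule someI2_ex)
  show "\<exists>S H. ident_step\<^sup>*\<^sup>* (edges_mset N L, {}) (H, S) \<and> ident_terminal (H, S)"
    using ident_step_terminates by fast
qed (use terminal_eq_patch_closure in blast)

section \<open>Rates depending on the size of an edge\<close>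

lemma sum_Pow_card:
  assumes "finite S"
  shows "(\<Sum>B\<in>Pow S. f (card B)) = (\<Sum>j\<le>card S. real (card S choose j) * f j)"
proof -
  have "(\<Sum>B\<in>Pow S. f (card B)) = (\<Sum>j\<le>card S. \<Sum>B | B \<in> Pow S \<and> card B = j. f (card B))"
    by (rule sum.group[symmetric]) (use assms in \<open>auto intro: card_mono\<close>)
  also have "\<dots> = (\<Sum>j\<le>card S. real (card S choose j) * f j)"
  proof (rule sum.cong)
    fix j
    have "(\<Sum>B | B \<in> Pow S \<and> card B = j. f (card B)) = (\<Sum>B | B \<subseteq> S \<and> card B = j. f j)"
      by (rule sum.cong) auto
    then show "(\<Sum>B | B \<in> Pow S \<and> card B = j. f (card B)) = real (card S choose j) * f j"
      by (simp add: n_subsets[OF assms])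
  qed simp
  finally show ?thesis .
qed

text \<open>The edges that add a vertex \<open>v\<close> to \<open>S\<close> are the sets \<open>insert v B\<close> with \<open>B \<subseteq> S\<close>.\<close>

lemma sum_escaping_edges:
  assumes "finite V" "S \<subseteq> U" "U \<subseteq> V"
  shows "(\<Sum>A\<in>escaping edge_fires (edge_sets V) S U. f (card A)) =
    real (card (U - S)) * (\<Sum>j\<le>card S. real (card S choose j) * f (Suc j))"
proof -
  have finite_S: "finite S"
    using assms by (meson finite_subset)
  have inj: "inj_on (\<lambda>(v, B). insert v B) ((U - S) \<times> Pow S)"
    by (rule inj_on_inverseI[where g = "\<lambda>A. (the_elem (A - S), A \<inter> S)"])
       (auto simp: insert_Diff_if Int_absorb2 Diff_eq_empty_iff[THEN iffD2])
  have image: "escaping edge_fires (edge_sets V) S U = (\<lambda>(v, B). insert v B) ` ((U - S) \<times> Pow S)"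
  proof (intro equalityI subsetI)
    fix A assume "A \<in> escaping edge_fires (edge_sets V) S U"
    then obtain v where "v \<in> U - S" "A - S = {v}"
      by (auto simp: escaping_def edge_fires_def)
    then show "A \<in> (\<lambda>(v, B). insert v B) ` ((U - S) \<times> Pow S)"
      by (intro image_eqI[of _ _ "(v, A \<inter> S)"]) auto
  next
    fix A assume "A \<in> (\<lambda>(v, B). insert v B) ` ((U - S) \<times> Pow S)"
    then obtain v B where "v \<in> U - S" "B \<subseteq> S" "A = insert v B"
      by auto
    moreover from this have "A - S = {v}"
      by auto
    ultimately show "A \<in> escaping edge_fires (edge_sets V) S U"
      using assms(2,3) by (auto simp: escaping_def edge_sets_def edge_fires_def)
  qed
  have "(\<Sum>A\<in>escaping edge_fires (edge_sets V) S U. f (card A)) =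
      (\<Sum>(v, B)\<in>(U - S) \<times> Pow S. f (card (insert v B)))"
    unfolding image sum.reindex[OF inj] by (simp add: case_prod_unfold)
  also have "\<dots> = (\<Sum>(v, B)\<in>(U - S) \<times> Pow S. f (Suc (card B)))"
    using finite_S by (intro sum.cong refl) (auto simp: finite_subset card_insert_if)
  also have "\<dots> = real (card (U - S)) * (\<Sum>B\<in>Pow S. f (Suc (card B)))"
    by (simp add: sum.cartesian_product[symmetric])
  finally show ?thesis
    by (simp add: sum_Pow_card[OF finite_S, of "\<lambda>n. f (Suc n)"])
qed

definition edge_rate :: "(nat \<Rightarrow> real) \<Rightarrow> nat \<Rightarrow> nat \<Rightarrow> real" where
  "edge_rate beta N k = real N * beta k / real (N choose k)"

definition fire_rate :: "(nat \<Rightarrow> real) \<Rightarrow> nat \<Rightarrow> nat \<Rightarrow> real" where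
  "fire_rate beta N n = (\<Sum>j\<le>n. real (n choose j) * edge_rate beta N (Suc j))"

lemma poisson_hypergraph_eq:
  "poisson_hypergraph beta N = pois_prod (edge_sets {..<N}) (\<lambda>A. edge_rate beta N (card A))"
proof -
  have "edge_sets {..<N} = {A. A \<subseteq> {..<N} \<and> A \<noteq> {}}"
    by (auto simp: edge_sets_def)
  then show ?thesis
    by (simp add: poisson_hypergraph_def pois_prod_def edge_rate_def)
qed

locale random_hypergraph =
  fixes V :: "'v set" and r :: "'v set \<Rightarrow> real"
  assumes finite_V: "finite V"
    and rate_nonneg: "\<And>A. A \<in> edge_sets V \<Longrightarrow> r A \<ge> 0"
begin

sublocale random_firing edge_fires V "edge_sets V" r
proof
  show "edge_fires A T v" if "edge_fires A S v" "S \<subseteq> T" "T \<subseteq> V" "v \<notin> T" for A S T v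
    using that by (auto simp: edge_fires_def)
  show "\<not> edge_fires A S w" if "edge_fires A T v" "T \<subseteq> S" "v \<in> S - T" "w \<notin> S" for A S T v w
  proof -
    have "A - S = {}"
      using that by (auto simp: edge_fires_def)
    then show ?thesis
      unfolding edge_fires_def by (simp only: empty_not_insert not_False_eq_True)
  qed
qed (simp_all add: finite_edge_sets finite_V rate_nonneg)

end

section \<open>Essential edges\<close>

definition pivotal :: "'v set \<Rightarrow> 'v set \<Rightarrow> ('v set \<Rightarrow> nat) \<Rightarrow> bool" where
  "pivotal V A L \<longleftrightarrow> card (A - patch_closure V (L(A := 0))) = 1"

definition essential :: "'v set \<Rightarrow> 'v set \<Rightarrow> ('v set \<Rightarrow> nat) \<Rightarrow> bool" where
  "essential V A L \<longleftrightarrow> L A = 1 \<and> pivotal V A L"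

lemma pivotal_fun_upd: "pivotal V A (L(A := n)) \<longleftrightarrow> pivotal V A L"
  by (simp add: pivotal_def)

lemma patch_closure_psubset_iff_pivotal:
  assumes "finite V" "A \<in> edge_sets V" "L A = 1"
  shows "patch_closure V (L(A := 0)) \<subset> patch_closure V L \<longleftrightarrow> pivotal V A L"
proof -
  have sub: "patch_closure V (L(A := 0)) \<subseteq> patch_closure V L"
    using assms(1) by (rule patch_closure_mono) (auto split: if_splits)
  have "patch_closure V L \<subseteq> patch_closure V (L(A := 0))" if "\<not> pivotal V A L"
  proof (rule patch_closure_least[OF patch_closure_subset])
    show "card (B - patch_closure V (L(A := 0))) \<noteq> 1" if "B \<in> edge_sets V" "L B > 0" for B
      using \<open>\<not> pivotal V A L\<close> patch_closure_closed[OF assms(1) that(1), of "L(A := 0)"] that(2)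
      by (cases "B = A") (auto simp: pivotal_def)
  qed
  moreover have "patch_closure V L \<noteq> patch_closure V (L(A := 0))" if "pivotal V A L"
    using that patch_closure_closed[OF assms(1,2), of L] assms(3) by (auto simp: pivotal_def)
  ultimately show ?thesis
    using sub by blast
qed

lemma essential_multiplicity_eq:
  assumes "A \<in> edge_sets {..<N}"
  shows "(if card (identifiable N (L(A := L A - 1))) < card (identifiable N L) then L A else 0) =
    of_bool (essential {..<N} A L)"
proof -
  let ?C = "patch_closure {..<N}"
  consider (absent) "L A = 0" | (simple) "L A = 1" | (multiple) "L A \<ge> 2"
    by linarith
  then show ?thesis
  proof cases
    case absent
    then show ?thesis
      by (simp add: essential_def)
  next
    case simple
    have "finite (?C L)"
      by (rule finite_subset[OF patch_closure_subset]) simp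
    moreover have "?C (L(A := 0)) \<subseteq> ?C L"
      by (rule patch_closure_mono) (auto split: if_splits)
    ultimately have "card (?C (L(A := 0))) < card (?C L) \<longleftrightarrow> ?C (L(A := 0)) \<subset> ?C L"
      by (auto intro: psubset_card_mono)
    then show ?thesis
      using simple patch_closure_psubset_iff_pivotal[OF _ assms, of L]
      by (simp add: identifiable_eq_patch_closure essential_def)
  next
    case multiple
    then have "?C (L(A := L A - 1)) = ?C L"
      by (intro patch_closure_cong) auto
    then show ?thesis
      using multiple by (simp add: identifiable_eq_patch_closure essential_def)
  qed
qed

lemma essential_count_eq:
  assumes "k \<ge> 1"
  shows "essential_count N k L =
    (\<Sum>A | A \<in> edge_sets {..<N} \<and> card A = k. of_bool (essential {..<N} A L))"
proof -
  have "{A. A \<subseteq> {..<N} \<and> card A = k} = {A \<in> edge_sets {..<N}. card A = k}"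
    using assms by (auto simp: edge_sets_def)
  then show ?thesis
    unfolding essential_count_def
    by (simp only:) (intro sum.cong refl essential_multiplicity_eq, simp)
qed

lemma essential_total_eq:
  "essential_total N L = (\<Sum>A\<in>edge_sets {..<N}. of_bool (essential {..<N} A L))"
proof -
  have "essential_total N L =
      (\<Sum>k=1..N. \<Sum>A | A \<in> edge_sets {..<N} \<and> card A = k. of_bool (essential {..<N} A L))"
    unfolding essential_total_def by (intro sum.cong refl essential_count_eq) simp
  also have "\<dots> = (\<Sum>A\<in>edge_sets {..<N}. of_bool (essential {..<N} A L))"
  proof (rule sum.group)
    show "card ` edge_sets {..<N} \<subseteq> {1..N}"
      using card_edge_set[of "{..<N}"] by auto
  qed (auto simp: finite_edge_sets)
  finally show ?thesis .
qed

lemma one_missing_iff_pivotal: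
  assumes "finite V" "A \<in> edge_sets V"
  shows "card (A - patch_closure V L) = 1 \<longleftrightarrow> L A = 0 \<and> pivotal V A L"
proof (cases "L A = 0")
  case True
  then have "L(A := 0) = L"
    by auto
  then show ?thesis
    using True by (simp add: pivotal_def)
next
  case False
  then show ?thesis
    using patch_closure_closed[OF assms, of L] by simp
qed

lemma essential_minus_compensator:
  assumes "finite V" "A \<in> edge_sets V"
  shows "of_bool (essential V A L) - r A * of_bool (card (A - patch_closure V L) = 1) =
    compensated r A L * of_bool (pivotal V A L)"
  unfolding one_missing_iff_pivotal[OF assms] by (simp add: essential_def compensated_def)

text \<open>Adding the edge \<open>B\<close> changes whether \<open>A\<close> is pivotal only if it identifies a vertex of \<open>A\<close>.\<close>

lemma add_point_diff_pivotal_le: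
  assumes "finite V" "A \<subseteq> V" "A \<noteq> B" "L A = 0" "L B = 0"
  shows "\<bar>add_point_diff B (\<lambda>L. of_bool (pivotal V A L)) L :: real\<bar> \<le>
    (\<Sum>v\<in>A. add_point_diff B (\<lambda>L. of_bool (v \<in> patch_closure V L)) L)"
proof -
  let ?gain = "\<lambda>v. add_point_diff B (\<lambda>L. of_bool (v \<in> patch_closure V L) :: real) L"
  have fun_upds: "L(B := 0) = L" "L(A := 0) = L" "L(B := 1, A := 0) = L(B := 1)"
    using assms by auto
  have mono: "patch_closure V L \<subseteq> patch_closure V (L(B := 1))"
    using assms by (intro patch_closure_mono) auto
  have gain: "?gain v = of_bool (v \<in> patch_closure V (L(B := 1)) - patch_closure V L)" for v
    using mono by (auto simp: add_point_diff_def fun_upds(1))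
  have diff: "add_point_diff B (\<lambda>L. of_bool (pivotal V A L)) L =
      (of_bool (card (A - patch_closure V (L(B := 1))) = 1) -
       of_bool (card (A - patch_closure V L) = 1) :: real)"
    unfolding add_point_diff_def pivotal_def fun_upds by simp
  show ?thesis
  proof (cases "\<exists>v\<in>A. v \<in> patch_closure V (L(B := 1)) - patch_closure V L")
    case True
    then obtain v where v: "v \<in> A" "?gain v = 1"
      using gain by auto
    have "?gain v \<le> (\<Sum>v\<in>A. ?gain v)"
      using v(1) finite_subset[OF assms(2,1)] by (intro member_le_sum) (auto simp: gain)
    then show ?thesis
      using v(2) unfolding diff by auto
  next
    case False
    then have "A - patch_closure V (L(B := 1)) = A - patch_closure V L"
      using mono by auto
    then show ?thesis
      unfolding diff using gain by (simp add: sum_nonneg)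
  qed
qed

context random_hypergraph
begin

definition identified :: "'v \<Rightarrow> ('v set \<Rightarrow> nat) \<Rightarrow> real" where
  "identified v L = of_bool (v \<in> patch_closure V L)"

lemma bounded_range_identified: "bounded (range (identified v))"
  unfolding identified_def by (rule bounded_range_of_bool)

lemma add_point_diff_identified_nonneg: "add_point_diff B (identified v) L \<ge> 0"
proof -
  have "patch_closure V (L(B := 0)) \<subseteq> patch_closure V (L(B := 1))"
    using finite_V by (rule patch_closure_mono) (auto split: if_splits)
  then show ?thesis
    by (auto simp: add_point_diff_def identified_def)
qed

lemma expect_compensated_identified_nonneg:
  "B \<in> edge_sets V \<Longrightarrow> 0 \<le> expect (\<lambda>L. compensated r B L * identified v L)"
  by (simp add: expect_compensated_mult bounded_range_identified rate_nonneg
      add_point_diff_identified_nonneg)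

definition pivotal_interaction :: "'v set \<Rightarrow> 'v set \<Rightarrow> real" where
  "pivotal_interaction A B =
    interaction A B (\<lambda>L. of_bool (pivotal V A L)) (\<lambda>L. of_bool (pivotal V B L))"

lemma pivotal_interaction_le:
  assumes "A \<in> edge_sets V" "B \<in> edge_sets V" "A \<noteq> B"
  shows "r B * pivotal_interaction A B \<le> (\<Sum>v\<in>A. expect (\<lambda>L. compensated r B L * identified v L))"
proof -
  let ?D = "\<lambda>A B L. add_point_diff B (\<lambda>L. of_bool (pivotal V A L) :: real) L"
  have "of_bool (L A = 0 \<and> L B = 0) * (?D A B L * ?D B A L) \<le>
      (\<Sum>v\<in>A. of_bool (L B = 0) * add_point_diff B (identified v) L)" for L
  proof (cases "L A = 0 \<and> L B = 0")
    case True
    have "?D A B L * ?D B A L \<le> \<bar>?D A B L\<bar> * \<bar>?D B A L\<bar>"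
      by (simp only: abs_mult[symmetric] abs_ge_self)
    also have "\<dots> \<le> \<bar>?D A B L\<bar> * 1"
      by (intro mult_left_mono) (auto simp: add_point_diff_def)
    also have "\<dots> \<le> (\<Sum>v\<in>A. add_point_diff B (identified v) L)"
      using add_point_diff_pivotal_le[OF finite_V edge_sets_imp_subset[OF assms(1)] assms(3)] True
      by (simp add: identified_def[abs_def])
    finally show ?thesis
      using True by simp
  next
    case False
    then show ?thesis
      by (auto intro!: sum_nonneg add_point_diff_identified_nonneg)
  qed
  then have "pivotal_interaction A B \<le>
      expect (\<lambda>L. \<Sum>v\<in>A. of_bool (L B = 0) * add_point_diff B (identified v) L)"
    unfolding pivotal_interaction_def interaction_def
    by (intro integral_mono integrable_measure_pmf_bounded bounded_range_intros
        bounded_range_add_point_diff bounded_range_identified)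
  also have "\<dots> = (\<Sum>v\<in>A. expect (\<lambda>L. of_bool (L B = 0) * add_point_diff B (identified v) L))"
    by (intro Bochner_Integration.integral_sum integrable_measure_pmf_bounded bounded_range_intros
        bounded_range_add_point_diff bounded_range_identified)
  finally show ?thesis
    using assms(2) rate_nonneg[OF assms(2)]
    by (simp add: expect_compensated_mult bounded_range_identified
        sum_distrib_left[symmetric] mult_left_mono)
qed

lemma sum_expect_compensated_identified_le:
  assumes "K \<subseteq> edge_sets V"
  shows "(\<Sum>B\<in>K. expect (\<lambda>L. compensated r B L * identified v L)) \<le> sqrt (sum r K)"
proof -
  have "(\<Sum>B\<in>K. expect (\<lambda>L. compensated r B L * identified v L)) =
      expect (\<lambda>L. (\<Sum>B\<in>K. compensated r B L) * identified v L)"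
    unfolding sum_distrib_right
    by (intro Bochner_Integration.integral_sum[symmetric] integrable_measure_pmf_bounded
        bounded_range_intros bounded_range_compensated bounded_range_identified)
  also have "\<dots> \<le> sqrt (expect (\<lambda>L. (\<Sum>B\<in>K. compensated r B L)\<^sup>2))"
    by (intro expectation_mult_le_sqrt_expectation_power2
        bounded_range_intros bounded_range_compensated)
       (simp add: identified_def)
  also have "\<dots> \<le> sqrt (sum r K)"
    using expect_sum_compensated_power2_le[OF assms] by simp
  finally show ?thesis .
qed

lemma sum_pivotal_interaction_le:
  assumes "K \<subseteq> edge_sets V" "A \<in> K"
  shows "(\<Sum>B\<in>K - {A}. r A * (r B * pivotal_interaction A B)) \<le> r A * real (card A) * sqrt (sum r K)"
proof -
  have "finite K"
    using finite_subset[OF assms(1)] finite_edge_sets[OF finite_V] .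
  have "(\<Sum>B\<in>K - {A}. r B * pivotal_interaction A B) \<le>
      (\<Sum>B\<in>K - {A}. \<Sum>v\<in>A. expect (\<lambda>L. compensated r B L * identified v L))"
    using assms by (intro sum_mono pivotal_interaction_le) auto
  also have "\<dots> \<le> (\<Sum>B\<in>K. \<Sum>v\<in>A. expect (\<lambda>L. compensated r B L * identified v L))"
    using assms(1) \<open>finite K\<close>
    by (intro sum_mono2) (auto intro!: sum_nonneg expect_compensated_identified_nonneg)
  also have "\<dots> = (\<Sum>v\<in>A. \<Sum>B\<in>K. expect (\<lambda>L. compensated r B L * identified v L))"
    by (rule sum.swap)
  also have "\<dots> \<le> (\<Sum>v\<in>A. sqrt (sum r K))"
    by (intro sum_mono sum_expect_compensated_identified_le assms(1))
  finally show ?thesis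
    using rate_nonneg[of A] assms
    by (simp add: sum_distrib_left[symmetric] mult.assoc mult_left_mono subset_iff)
qed

theorem expect_essential_deviation_le:
  assumes "K \<subseteq> edge_sets V"
  shows "expect (\<lambda>L. ((\<Sum>A\<in>K. of_bool (essential V A L)) -
      (\<Sum>A\<in>K. r A * of_bool (card (A - patch_closure V L) = 1)))\<^sup>2) \<le>
    sum r K + (\<Sum>A\<in>K. r A * real (card A)) * sqrt (sum r K)"
proof -
  have "expect (\<lambda>L. ((\<Sum>A\<in>K. of_bool (essential V A L)) -
      (\<Sum>A\<in>K. r A * of_bool (card (A - patch_closure V L) = 1)))\<^sup>2) =
      expect (\<lambda>L. (\<Sum>A\<in>K. compensated r A L * of_bool (pivotal V A L))\<^sup>2)"
    unfolding sum_subtractf[symmetric] using assms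
    by (intro arg_cong[where f = expect] ext arg_cong[where f = "\<lambda>x. x\<^sup>2"] sum.cong refl
        essential_minus_compensator finite_V) auto
  also have "\<dots> \<le> sum r K + (\<Sum>A\<in>K. \<Sum>B\<in>K - {A}. r A * (r B * pivotal_interaction A B))"
    unfolding pivotal_interaction_def using assms
    by (intro expect_sum_compensated_mult_power2_le) (simp_all add: pivotal_fun_upd)
  also have "\<dots> \<le> sum r K + (\<Sum>A\<in>K. r A * real (card A)) * sqrt (sum r K)"
    unfolding sum_distrib_right by (intro add_left_mono sum_mono sum_pivotal_interaction_le assms)
  finally show ?thesis .
qed

end

section \<open>Convergence in probability\<close>

definition vanishes_in_prob :: "(nat \<Rightarrow> 'a pmf) \<Rightarrow> (nat \<Rightarrow> 'a \<Rightarrow> bool) \<Rightarrow> bool" where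
  "vanishes_in_prob P A \<longleftrightarrow> (\<lambda>N. measure_pmf.prob (P N) {x. A N x}) \<longlonglongrightarrow> 0"

lemma conv_in_prob_iff_vanishes:
  "conv_in_prob P X c \<longleftrightarrow> (\<forall>e>0. vanishes_in_prob P (\<lambda>N x. \<bar>X N x - c\<bar> > e))"
  by (simp add: conv_in_prob_def vanishes_in_prob_def)

lemma conv_in_prob_imp_vanishes:
  "conv_in_prob P X c \<Longrightarrow> e > 0 \<Longrightarrow> vanishes_in_prob P (\<lambda>N x. \<bar>X N x - c\<bar> > e)"
  by (simp add: conv_in_prob_iff_vanishes)

lemma vanishes_in_prob_mono:
  assumes "vanishes_in_prob P A" "\<forall>\<^sub>F N in sequentially. \<forall>x. B N x \<longrightarrow> A N x"
  shows "vanishes_in_prob P B"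
  unfolding vanishes_in_prob_def
proof (rule tendsto_sandwich[OF _ _ tendsto_const assms(1)[unfolded vanishes_in_prob_def]])
  show "\<forall>\<^sub>F N in sequentially.
      measure_pmf.prob (P N) {x. B N x} \<le> measure_pmf.prob (P N) {x. A N x}"
    using assms(2) by eventually_elim (intro measure_pmf.finite_measure_mono, auto)
qed simp

lemma vanishes_in_prob_disj:
  assumes "vanishes_in_prob P A" "vanishes_in_prob P B"
  shows "vanishes_in_prob P (\<lambda>N x. A N x \<or> B N x)"
proof -
  have "\<forall>\<^sub>F N in sequentially. measure_pmf.prob (P N) {x. A N x \<or> B N x} \<le>
      measure_pmf.prob (P N) {x. A N x} + measure_pmf.prob (P N) {x. B N x}"
    unfolding Collect_disj_eq by (intro always_eventually allI measure_Un_le) auto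
  moreover have "(\<lambda>N. measure_pmf.prob (P N) {x. A N x} + measure_pmf.prob (P N) {x. B N x}) \<longlonglongrightarrow> 0"
    using assms unfolding vanishes_in_prob_def by (rule tendsto_add_zero)
  ultimately show ?thesis
    unfolding vanishes_in_prob_def by (rule tendsto_sandwich[OF _ _ tendsto_const, rotated]) simp
qed

lemma vanishes_in_prob_bex:
  assumes "finite J" "\<And>j. j \<in> J \<Longrightarrow> vanishes_in_prob P (A j)"
  shows "vanishes_in_prob P (\<lambda>N x. \<exists>j\<in>J. A j N x)"
  using assms
proof (induction J)
  case empty
  then show ?case
    by (simp add: vanishes_in_prob_def)
next
  case (insert j J)
  then have "vanishes_in_prob P (\<lambda>N x. A j N x \<or> (\<exists>j\<in>J. A j N x))"
    by (intro vanishes_in_prob_disj) auto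
  then show ?case
    by simp
qed

lemma vanishes_in_prob_L2:
  fixes X :: "nat \<Rightarrow> 'a \<Rightarrow> real"
  assumes "(\<lambda>N. measure_pmf.expectation (P N) (\<lambda>x. (X N x)\<^sup>2)) \<longlonglongrightarrow> 0"
    and "\<And>N. bounded (range (X N))" and "e > 0"
  shows "vanishes_in_prob P (\<lambda>N x. \<bar>X N x\<bar> \<ge> e)"
  unfolding vanishes_in_prob_def
proof (rule tendsto_sandwich[OF _ _ tendsto_const])
  show "\<forall>\<^sub>F N in sequentially. measure_pmf.prob (P N) {x. \<bar>X N x\<bar> \<ge> e} \<le>
      measure_pmf.expectation (P N) (\<lambda>x. (X N x)\<^sup>2) / e\<^sup>2"
    using measure_pmf.second_moment_method[OF _ integrable_measure_pmf_bounded, of _ "P _" e]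
      assms(2,3)
    by (auto intro!: always_eventually bounded_range_power2)
  show "(\<lambda>N. measure_pmf.expectation (P N) (\<lambda>x. (X N x)\<^sup>2) / e\<^sup>2) \<longlonglongrightarrow> 0"
    using tendsto_divide[OF assms(1) tendsto_const, of "e\<^sup>2"] assms(3) by simp
qed simp

lemma conv_in_prob_const:
  assumes "a \<longlonglongrightarrow> c"
  shows "conv_in_prob P (\<lambda>N _. a N) c"
  unfolding conv_in_prob_def
proof (intro allI impI)
  fix e :: real assume "e > 0"
  from tendstoD[OF assms this]
  show "(\<lambda>N. measure_pmf.prob (P N) {x. \<bar>a N - c\<bar> > e}) \<longlonglongrightarrow> 0"
    by (intro tendsto_eventually) (auto elim!: eventually_mono simp: dist_real_def)
qed

lemma conv_in_prob_L2_close: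
  assumes conv: "conv_in_prob P Y c"
    and close: "(\<lambda>N. measure_pmf.expectation (P N) (\<lambda>x. (X N x - Y N x)\<^sup>2)) \<longlonglongrightarrow> 0"
    and bounded: "\<And>N. bounded (range (X N))" "\<And>N. bounded (range (Y N))"
  shows "conv_in_prob P X c"
  unfolding conv_in_prob_iff_vanishes
proof (intro allI impI)
  fix e :: real assume "e > 0"
  then have "vanishes_in_prob P (\<lambda>N x. \<bar>X N x - Y N x\<bar> \<ge> e / 2 \<or> \<bar>Y N x - c\<bar> > e / 2)"
    by (intro vanishes_in_prob_disj vanishes_in_prob_L2 conv_in_prob_imp_vanishes conv close
        bounded_minus_comp bounded) auto
  then show "vanishes_in_prob P (\<lambda>N x. \<bar>X N x - c\<bar> > e)"
    by (rule vanishes_in_prob_mono) (intro always_eventually allI impI, arith)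
qed

definition density_filter :: "real \<Rightarrow> (nat \<times> nat) filter" where
  "density_filter t = filtercomap (\<lambda>(N, s). (N, real s / real N)) (at_top \<times>\<^sub>F nhds t)"

lemma filterlim_joint_density_filter:
  "filterlim (\<lambda>(N, s). (N, real s / real N)) (at_top \<times>\<^sub>F nhds t) (density_filter t)"
  unfolding density_filter_def by (rule filterlim_filtercomap)

lemma filterlim_fst_density_filter: "filterlim fst at_top (density_filter t)"
  using filterlim_compose[OF filterlim_fst filterlim_joint_density_filter]
  by (simp add: case_prod_unfold)

lemma tendsto_density_filter: "((\<lambda>p. real (snd p) / real (fst p)) \<longlongrightarrow> t) (density_filter t)"
  using filterlim_compose[OF filterlim_snd filterlim_joint_density_filter]
  by (simp add: case_prod_unfold)

lemma conv_in_prob_compose_density: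
  fixes f :: "nat \<times> nat \<Rightarrow> real" and S :: "nat \<Rightarrow> 'a \<Rightarrow> nat"
  assumes conv: "conv_in_prob P (\<lambda>N x. real (S N x) / real N) t"
    and lim: "(f \<longlongrightarrow> c) (density_filter t)"
  shows "conv_in_prob P (\<lambda>N x. f (N, S N x)) c"
  unfolding conv_in_prob_iff_vanishes
proof (intro allI impI)
  fix e :: real assume "e > 0"
  from tendstoD[OF lim this] obtain A B where "eventually A at_top" "eventually B (nhds t)"
    and close: "\<And>N s. A N \<Longrightarrow> B (real s / real N) \<Longrightarrow> dist (f (N, s)) c < e"
    unfolding density_filter_def eventually_filtercomap eventually_prod_filter by fastforce
  then obtain d where "d > 0" and near_t: "\<And>y. dist y t < d \<Longrightarrow> B y"
    unfolding eventually_nhds_metric by blast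
  have "vanishes_in_prob P (\<lambda>N x. \<bar>real (S N x) / real N - t\<bar> > d / 2)"
    using conv half_gt_zero[OF \<open>d > 0\<close>] by (rule conv_in_prob_imp_vanishes)
  then show "vanishes_in_prob P (\<lambda>N x. \<bar>f (N, S N x) - c\<bar> > e)"
  proof (rule vanishes_in_prob_mono)
    show "\<forall>\<^sub>F N in sequentially. \<forall>x. \<bar>f (N, S N x) - c\<bar> > e \<longrightarrow> \<bar>real (S N x) / real N - t\<bar> > d / 2"
      using \<open>eventually A at_top\<close>
    proof (eventually_elim, intro allI impI)
      fix N x assume "A N" "\<bar>f (N, S N x) - c\<bar> > e"
      then have "\<not> dist (real (S N x) / real N) t < d"
        using close[of N "S N x"] near_t by (auto simp: dist_real_def)
      then show "\<bar>real (S N x) / real N - t\<bar> > d / 2"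
        using \<open>d > 0\<close> by (simp add: dist_real_def)
    qed
  qed
qed

section \<open>Asymptotics of the rates\<close>

lemma binomial_ratio_tendsto:
  fixes s n :: "'a \<Rightarrow> nat"
  assumes n: "filterlim n at_top F" and s: "((\<lambda>x. real (s x) / real (n x)) \<longlongrightarrow> t) F"
  shows "((\<lambda>x. real (s x choose j) / real (n x - 1 choose j)) \<longlongrightarrow> t ^ j) F"
proof -
  have inverse_n: "((\<lambda>x. c / real (n x)) \<longlongrightarrow> 0) F" for c
    by (rule tendsto_divide_0[OF tendsto_const])
       (intro filterlim_at_top_imp_at_infinity filterlim_compose[OF filterlim_real_sequentially n])
  have "((\<lambda>x. \<Prod>i<j. (real (s x) / real (n x) - real i / real (n x)) / (1 - (1 + real i) / real (n x)))
      \<longlongrightarrow> (\<Prod>i<j. (t - 0) / (1 - 0))) F"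
    by (intro tendsto_prod tendsto_divide tendsto_diff s inverse_n tendsto_const) simp
  moreover have "\<forall>\<^sub>F x in F.
      (\<Prod>i<j. (real (s x) / real (n x) - real i / real (n x)) / (1 - (1 + real i) / real (n x))) =
      real (s x choose j) / real (n x - 1 choose j)"
    using n[unfolded filterlim_at_top, rule_format, of 1]
  proof eventually_elim
    case (elim x)
    have "(real (s x) / real (n x) - real i / real (n x)) / (1 - (1 + real i) / real (n x)) =
        (real (s x) - real i) / (real (n x - 1) - real i)" for i
    proof -
      have "1 - (1 + real i) / real (n x) = (real (n x - 1) - real i) / real (n x)"
        using elim by (simp add: field_simps of_nat_diff)
      then show ?thesis
        using elim by (simp add: diff_divide_distrib[symmetric])
    qed
    then show ?case
      by (simp add: binomial_gbinomial gbinomial_prod_rev prod_dividef lessThan_atLeast0)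
  qed
  ultimately show ?thesis
    by (simp add: tendsto_cong)
qed

lemma edge_rate_Suc:
  assumes "N \<ge> 1"
  shows "edge_rate beta N (Suc j) = real (Suc j) * beta (Suc j) / real (N - 1 choose j)"
proof (cases "Suc j \<le> N")
  case True
  have "real (Suc j) * real (N choose Suc j) = real N * real (N - 1 choose j)"
    using Suc_times_binomial_eq[of "N - 1" j] assms unfolding of_nat_mult[symmetric]
    by (simp add: mult.commute)
  then have "real N * beta (Suc j) * real (N - 1 choose j) =
      real (Suc j) * beta (Suc j) * real (N choose Suc j)"
    by (metis mult.assoc mult.commute)
  moreover have "real (N choose Suc j) \<noteq> 0" "real (N - 1 choose j) \<noteq> 0"
    using True by auto
  ultimately show ?thesis
    unfolding edge_rate_def by (intro iffD2[OF frac_eq_eq])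
next
  case False
  then show ?thesis
    using assms by (simp add: edge_rate_def binomial_eq_0)
qed

definition beta_deriv :: "(nat \<Rightarrow> real) \<Rightarrow> real \<Rightarrow> real" where
  "beta_deriv beta t = (\<Sum>j. real (Suc j) * beta (Suc j) * t ^ j)"

locale edge_weights =
  fixes beta :: "nat \<Rightarrow> real"
  assumes weights_nonneg: "\<And>k. k \<ge> 1 \<Longrightarrow> beta k \<ge> 0"
    and summable_weights: "summable (\<lambda>k. real (Suc k) * beta (Suc k))"
begin

lemma edge_rate_nonneg: "k \<ge> 1 \<Longrightarrow> edge_rate beta N k \<ge> 0"
  using weights_nonneg by (simp add: edge_rate_def)

lemma norm_beta_deriv_term_le:
  assumes "\<bar>t\<bar> \<le> 1"
  shows "norm (real (Suc j) * beta (Suc j) * t ^ j) \<le> real (Suc j) * beta (Suc j)"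
  using assms weights_nonneg
  by (auto simp: abs_mult power_abs intro!: mult_right_le_one_le power_le_one)

lemma summable_beta_deriv: "\<bar>t\<bar> \<le> 1 \<Longrightarrow> summable (\<lambda>j. real (Suc j) * beta (Suc j) * t ^ j)"
  using norm_beta_deriv_term_le by (intro summable_comparison_test'[OF summable_weights, of 0]) auto

lemma beta_deriv_le:
  assumes "\<bar>t\<bar> \<le> 1"
  shows "beta_deriv beta t \<le> beta_deriv beta 1"
proof -
  have "real (Suc j) * beta (Suc j) * t ^ j \<le> real (Suc j) * beta (Suc j) * 1 ^ j" for j
    using norm_beta_deriv_term_le[OF assms, of j] by (simp add: abs_le_iff)
  then show ?thesis
    unfolding beta_deriv_def using assms by (intro suminf_le summable_beta_deriv) auto
qed

lemma beta_deriv_1_nonneg: "beta_deriv beta 1 \<ge> 0"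
  unfolding beta_deriv_def using weights_nonneg by (intro suminf_nonneg summable_beta_deriv) auto

lemma deriv_beta_fun:
  assumes "\<bar>t\<bar> < 1"
  shows "deriv (beta_fun beta) t = beta_deriv beta t"
proof -
  define coeff0 where "coeff0 n = (if n = 0 then 0 else beta n)" for n
  have summable_coeff0: "summable (\<lambda>n. coeff0 n * z ^ n)" if "norm z < 1" for z :: real
  proof (subst summable_Suc_iff[symmetric], rule summable_comparison_test'[OF summable_weights, of 0])
    fix n
    have "beta (Suc n) * \<bar>z\<bar> ^ Suc n \<le> beta (Suc n) * real (Suc n)"
      using that weights_nonneg power_le_one[of "\<bar>z\<bar>" "Suc n"] by (intro mult_left_mono) auto
    then show "norm (coeff0 (Suc n) * z ^ Suc n) \<le> real (Suc n) * beta (Suc n)"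
      using weights_nonneg[of "Suc n"] by (simp add: coeff0_def abs_mult power_abs mult.commute)
  qed
  have "((\<lambda>z. \<Sum>n. coeff0 n * z ^ n) has_field_derivative (\<Sum>n. diffs coeff0 n * t ^ n)) (at t)"
    by (rule termdiffs_strong'[where K = 1]) (use summable_coeff0 assms in auto)
  moreover have "(\<Sum>n. diffs coeff0 n * t ^ n) = beta_deriv beta t"
    by (simp add: diffs_def beta_deriv_def coeff0_def)
  moreover have "(\<Sum>n. coeff0 n * z ^ n) = beta_fun beta z" if "norm z < 1" for z
    using suminf_split_head[OF summable_coeff0[OF that]] by (simp add: beta_fun_def coeff0_def)
  then have "\<forall>\<^sub>F z in nhds t. (\<Sum>n. coeff0 n * z ^ n) = beta_fun beta z"
    using assms by (intro eventually_nhds_in_open[of "ball 0 1", THEN eventually_mono]) auto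
  ultimately have "(beta_fun beta has_field_derivative beta_deriv beta t) (at t)"
    by (subst (asm) DERIV_cong_ev[OF refl _ refl]) auto
  then show ?thesis
    by (rule DERIV_imp_deriv)
qed

lemma isCont_beta_deriv:
  assumes "\<bar>t\<bar> < 1"
  shows "isCont (beta_deriv beta) t"
  unfolding beta_deriv_def
  by (rule isCont_powser[where K = 1]) (use summable_beta_deriv[of 1] assms in auto)

lemma mono_fire_rate: "mono (fire_rate beta N)"
proof (rule monoI)
  fix m n :: nat assume mn: "m \<le> n"
  have "fire_rate beta N m \<le> (\<Sum>j\<le>m. real (n choose j) * edge_rate beta N (Suc j))"
    unfolding fire_rate_def using edge_rate_nonneg mn
    by (intro sum_mono mult_right_mono) (auto intro: binomial_right_mono)
  also have "\<dots> \<le> fire_rate beta N n"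
    unfolding fire_rate_def using edge_rate_nonneg mn by (intro sum_mono2) auto
  finally show "fire_rate beta N m \<le> fire_rate beta N n" .
qed

definition fire_rate_summand :: "nat \<Rightarrow> nat \<Rightarrow> nat \<Rightarrow> real" where
  "fire_rate_summand N s j =
    real (Suc j) * beta (Suc j) * (real (s choose j) / real (N - 1 choose j))"

lemma fire_rate_eq_suminf:
  assumes "N \<ge> 1"
  shows "fire_rate beta N s = (\<Sum>j. fire_rate_summand N s j)"
proof -
  have "(\<Sum>j. fire_rate_summand N s j) = (\<Sum>j\<le>s. fire_rate_summand N s j)"
    by (rule suminf_finite) (auto simp: fire_rate_summand_def binomial_eq_0)
  then show ?thesis
    using assms by (simp add: fire_rate_def fire_rate_summand_def edge_rate_Suc mult.commute)
qed

lemma norm_fire_rate_summand_le: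
  assumes "s < N"
  shows "norm (fire_rate_summand N s j) \<le> real (Suc j) * beta (Suc j)"
proof -
  have "real (s choose j) / real (N - 1 choose j) \<le> 1"
    using assms binomial_right_mono[of s "N - 1" j] by (simp add: divide_le_eq_1) linarith
  then have "real (Suc j) * beta (Suc j) * (real (s choose j) / real (N - 1 choose j)) \<le>
      real (Suc j) * beta (Suc j) * 1"
    using weights_nonneg by (intro mult_left_mono) auto
  then show ?thesis
    using weights_nonneg[of "Suc j"] by (simp add: fire_rate_summand_def abs_mult)
qed

lemma fire_rate_tendsto:
  fixes n s :: "'a \<Rightarrow> nat"
  assumes n: "filterlim n at_top F" and s: "((\<lambda>x. real (s x) / real (n x)) \<longlongrightarrow> t) F" and t: "t < 1"
  shows "((\<lambda>x. fire_rate beta (n x) (s x)) \<longlongrightarrow> beta_deriv beta t) F"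
proof (cases "F = bot")
  case False
  have s_less_n: "\<forall>\<^sub>F x in F. s x < n x"
    using order_tendstoD(2)[OF s t] n[unfolded filterlim_at_top, rule_format, of 1]
    by eventually_elim (simp add: divide_less_eq)
  have "((\<lambda>x. \<Sum>j. fire_rate_summand (n x) (s x) j) \<longlongrightarrow> beta_deriv beta t) F"
    unfolding beta_deriv_def
  proof (intro tannerys_theorem[THEN conjunct2, THEN conjunct2] False)
    show "((\<lambda>x. fire_rate_summand (n x) (s x) j) \<longlongrightarrow> real (Suc j) * beta (Suc j) * t ^ j) F" for j
      unfolding fire_rate_summand_def
      by (intro tendsto_mult tendsto_const binomial_ratio_tendsto n s)
    have "\<forall>\<^sub>F p in at_top \<times>\<^sub>F F. True \<and> s (snd p) < n (snd p)"
      by (rule eventually_prodI[of "\<lambda>_. True"]) (auto intro: s_less_n)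
    then show "\<forall>\<^sub>F (j, x) in at_top \<times>\<^sub>F F.
        norm (fire_rate_summand (n x) (s x) j) \<le> real (Suc j) * beta (Suc j)"
      by eventually_elim (use norm_fire_rate_summand_le in auto)
  qed (rule summable_weights)
  moreover have "\<forall>\<^sub>F x in F. (\<Sum>j. fire_rate_summand (n x) (s x) j) = fire_rate beta (n x) (s x)"
    using s_less_n by eventually_elim (simp add: fire_rate_eq_suminf)
  ultimately show ?thesis
    by (simp add: tendsto_cong)
qed simp

lemma sum_edge_rate_card_le:
  "(\<Sum>A\<in>edge_sets {..<N}. edge_rate beta N (card A) * real (card A)) \<le> real N * beta_deriv beta 1"
proof -
  have "(\<Sum>A\<in>edge_sets {..<N}. edge_rate beta N (card A) * real (card A)) =
      (\<Sum>A\<in>Pow {..<N}. edge_rate beta N (card A) * real (card A))"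
    by (intro sum.mono_neutral_left) (auto simp: edge_sets_def)
  also have "\<dots> = (\<Sum>k\<le>N. real (N choose k) * (edge_rate beta N k * real k))"
    using sum_Pow_card[of "{..<N}" "\<lambda>k. edge_rate beta N k * real k"] by simp
  also have "\<dots> = (\<Sum>k\<le>N. real N * (real k * beta k))"
    by (intro sum.cong) (auto simp: edge_rate_def)
  also have "\<dots> = real N * (\<Sum>j<N. real (Suc j) * beta (Suc j))"
    by (simp add: sum_distrib_left[symmetric] sum.atMost_shift)
  also have "\<dots> \<le> real N * (\<Sum>j. real (Suc j) * beta (Suc j))"
    using weights_nonneg summable_weights by (intro mult_left_mono sum_le_suminf) auto
  finally show ?thesis
    by (simp add: beta_deriv_def)
qed

end

definition weights_on :: "nat set \<Rightarrow> (nat \<Rightarrow> real) \<Rightarrow> nat \<Rightarrow> real" where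
  "weights_on W beta k = (if k \<in> W then beta k else 0)"

lemma weights_on_UNIV: "weights_on UNIV beta = beta"
  by (simp add: weights_on_def fun_eq_iff)

lemma (in edge_weights) edge_weights_weights_on: "edge_weights (weights_on W beta)"
proof
  show "weights_on W beta k \<ge> 0" if "k \<ge> 1" for k
    using weights_nonneg[OF that] by (simp add: weights_on_def)
  show "summable (\<lambda>k. real (Suc k) * weights_on W beta (Suc k))"
    by (rule summable_comparison_test'[OF summable_weights, of 0]) (use weights_nonneg in \<open>auto simp: weights_on_def\<close>)
qed

lemma beta_deriv_weights_on_singleton:
  assumes "k \<ge> 1"
  shows "beta_deriv (weights_on {k} beta) t = real k * beta k * t ^ (k - 1)"
proof -
  have "beta_deriv (weights_on {k} beta) t =
      (\<Sum>j\<in>{k - 1}. real (Suc j) * weights_on {k} beta (Suc j) * t ^ j)"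
    unfolding beta_deriv_def using assms by (intro suminf_finite) (auto simp: weights_on_def)
  then show ?thesis
    using assms by (simp add: weights_on_def)
qed

section \<open>The fixed point\<close>

context edge_weights
begin

definition drift :: "real \<Rightarrow> real" where
  "drift t = beta_deriv beta t + ln (1 - t)"

definition reach_limit :: "real \<Rightarrow> real" where
  "reach_limit t = 1 - exp (- beta_deriv beta t)"

lemma drift_less_0_iff: "t < 1 \<Longrightarrow> drift t < 0 \<longleftrightarrow> reach_limit t < t"
  using exp_less_cancel_iff[of "ln (1 - t)" "- beta_deriv beta t"]
  by (auto simp: drift_def reach_limit_def)

lemma drift_greater_0_iff: "t < 1 \<Longrightarrow> drift t > 0 \<longleftrightarrow> t < reach_limit t"
  using exp_less_cancel_iff[of "- beta_deriv beta t" "ln (1 - t)"]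
  by (auto simp: drift_def reach_limit_def)

lemma tstar_eq: "tstar beta = Inf {t. 0 \<le> t \<and> t < 1 \<and> drift t < 0}"
  unfolding tstar_def by (intro arg_cong[where f = Inf]) (auto simp: drift_def deriv_beta_fun)

lemma ex_drift_neg: "\<exists>t. 0 \<le> t \<and> t < 1 \<and> drift t < 0"
proof (intro exI conjI)
  let ?t = "1 - exp (- (beta_deriv beta 1 + 1))"
  show t: "0 \<le> ?t" "?t < 1"
    using beta_deriv_1_nonneg by auto
  then show "drift ?t < 0"
    using beta_deriv_le[of ?t] by (simp add: drift_def)
qed

lemma tstar_le:
  assumes "0 \<le> t" "t < 1" "drift t < 0"
  shows "tstar beta \<le> t"
  unfolding tstar_eq using assms by (intro cInf_lower bdd_belowI[of _ 0]) auto

lemma tstar_nonneg: "0 \<le> tstar beta"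
  unfolding tstar_eq using ex_drift_neg by (intro cInf_greatest) auto

lemma tstar_less_1: "tstar beta < 1"
  using ex_drift_neg tstar_le by fastforce

lemma drift_neg_above_tstar:
  assumes "tstar beta < u"
  obtains t where "tstar beta \<le> t" "t < u" "t < 1" "drift t < 0"
proof -
  have "\<exists>t\<in>{t. 0 \<le> t \<and> t < 1 \<and> drift t < 0}. t < u"
    using assms ex_drift_neg unfolding tstar_eq
    by (subst cInf_less_iff[symmetric]) (auto intro: bdd_belowI[of _ 0])
  then show ?thesis
    using that tstar_le by blast
qed

lemma drift_nonneg_below_tstar: "0 \<le> t \<Longrightarrow> t < tstar beta \<Longrightarrow> drift t \<ge> 0"
  using tstar_le[of t] tstar_less_1 by fastforce

lemma isCont_drift: "\<bar>t\<bar> < 1 \<Longrightarrow> isCont drift t"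
  unfolding drift_def by (intro continuous_intros isCont_beta_deriv) auto

lemma drift_tstar: "drift (tstar beta) = 0"
proof (rule antisym)
  have cont: "drift \<midarrow>tstar beta\<rightarrow> drift (tstar beta)"
    using isCont_drift tstar_nonneg tstar_less_1 by (simp add: isCont_def)
  show "drift (tstar beta) \<ge> 0"
  proof (cases "tstar beta = 0")
    case True
    then show ?thesis
      using powser_zero[of "\<lambda>j. real (Suc j) * beta (Suc j)"] weights_nonneg[of 1]
      by (simp add: drift_def beta_deriv_def)
  next
    case False
    show ?thesis
    proof (rule tendsto_lowerbound)
      show "(drift \<longlongrightarrow> drift (tstar beta)) (at_left (tstar beta))"
        using cont by (rule tendsto_within_subset) auto
      have "\<forall>\<^sub>F t in at_left (tstar beta). t \<in> {0<..<tstar beta}"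
        using False tstar_nonneg by (intro eventually_at_left_real) auto
      then show "\<forall>\<^sub>F t in at_left (tstar beta). 0 \<le> drift t"
        by eventually_elim (simp add: drift_nonneg_below_tstar)
    qed simp
  qed
  show "drift (tstar beta) \<le> 0"
  proof (rule ccontr)
    assume pos: "\<not> drift (tstar beta) \<le> 0"
    then obtain e where e: "e > 0" "\<And>t. t \<noteq> tstar beta \<Longrightarrow> dist t (tstar beta) < e \<Longrightarrow> drift t > 0"
      using order_tendstoD(1)[OF cont, of 0] by (auto simp: eventually_at)
    obtain t where "tstar beta \<le> t" "t < tstar beta + e" "drift t < 0"
      using drift_neg_above_tstar[of "tstar beta + e"] e(1) by auto
    then show False
      using e(2)[of t] pos by (cases "t = tstar beta") (auto simp: dist_real_def)
  qed
qed

section \<open>Concentration of the number of identifiable vertices\<close>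

lemma threshold_system_fire_rate: "threshold_system {..<N} (fire_rate beta N)"
  by unfold_locales (simp_all add: fire_rate_def edge_rate_nonneg mono_fire_rate)

lemma random_hypergraph_edge_rate: "random_hypergraph {..<N} (\<lambda>A. edge_rate beta N (card A))"
  by unfold_locales (auto intro: edge_rate_nonneg card_edge_set(1)[OF finite_lessThan])

abbreviation thresholds :: "nat \<Rightarrow> (nat \<times> nat \<Rightarrow> nat) pmf" where
  "thresholds N \<equiv> threshold_law {..<N} (fire_rate beta N)"

lemma prob_patch_closure:
  "measure_pmf.prob (poisson_hypergraph beta N) {L. Q (patch_closure {..<N} L)} =
    measure_pmf.prob (thresholds N) {L. Q (threshold_closure {..<N} L)}"
proof -
  interpret edges: random_hypergraph "{..<N}" "\<lambda>A. edge_rate beta N (card A)"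
    by (rule random_hypergraph_edge_rate)
  interpret thresholds: threshold_system "{..<N}" "fire_rate beta N"
    by (rule threshold_system_fire_rate)
  show ?thesis
    unfolding poisson_hypergraph_eq patch_closure_def threshold_law_def threshold_closure_def
  proof (rule random_firing_law_unique[OF edges.random_firing_axioms thresholds.random_firing_axioms])
    fix S U :: "nat set" assume SU: "S \<subseteq> U" "U \<subseteq> {..<N}"
    show "(\<Sum>A\<in>escaping edge_fires (edge_sets {..<N}) S U. edge_rate beta N (card A)) =
        sum (threshold_rate (fire_rate beta N))
          (escaping threshold_fires ({..<N} \<times> {..card {..<N}}) S U)"
      unfolding thresholds.sum_threshold_rate_escaping[OF SU]
        sum_escaping_edges[OF finite_lessThan SU] fire_rate_def ..
  qed
qed

lemma floor_density_tendsto: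
  assumes "0 \<le> t"
  shows "(\<lambda>N. real (nat \<lfloor>t * real N\<rfloor>) / real N) \<longlonglongrightarrow> t"
proof (rule tendsto_sandwich)
  show "\<forall>\<^sub>F N in sequentially. t - 1 / real N \<le> real (nat \<lfloor>t * real N\<rfloor>) / real N"
    using eventually_gt_at_top[of 0]
  proof eventually_elim
    case (elim N)
    have "t * real N - 1 \<le> real (nat \<lfloor>t * real N\<rfloor>)"
      by linarith
    then have "(t * real N - 1) / real N \<le> real (nat \<lfloor>t * real N\<rfloor>) / real N"
      by (rule divide_right_mono) simp
    then show ?case
      using elim by (simp add: diff_divide_distrib)
  qed
  show "\<forall>\<^sub>F N in sequentially. real (nat \<lfloor>t * real N\<rfloor>) / real N \<le> t"
    using eventually_gt_at_top[of 0]
    by eventually_elim (use assms in \<open>simp add: pos_divide_le_eq of_nat_floor\<close>)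
  show "(\<lambda>N. t - 1 / real N) \<longlonglongrightarrow> t"
    using tendsto_diff[OF tendsto_const lim_1_over_n, of t] by simp
qed simp

definition reached_density :: "real \<Rightarrow> nat \<Rightarrow> (nat \<times> nat \<Rightarrow> nat) \<Rightarrow> real" where
  "reached_density t N L = real (card (reached {..<N} L (nat \<lfloor>t * real N\<rfloor>))) / real N"

lemma bounded_range_reached_density: "bounded (range (reached_density t N))"
proof (rule boundedI)
  fix y assume "y \<in> range (reached_density t N)"
  then show "norm y \<le> 1"
    using card_mono[OF finite_lessThan reached_subset, of N]
    by (cases "N = 0") (auto simp: reached_density_def)
qed

lemma expectation_reached_density_deviation_le:
  fixes t :: real and N :: nat
  defines "mean \<equiv> 1 - exp (- fire_rate beta N (nat \<lfloor>t * real N\<rfloor>))"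
  assumes t: "0 \<le> t" "t < 1" and "N > 0"
  shows "measure_pmf.expectation (thresholds N) (\<lambda>L. (reached_density t N L - mean)\<^sup>2) \<le> 1 / real N"
proof -
  interpret threshold_system "{..<N}" "fire_rate beta N"
    by (rule threshold_system_fire_rate)
  let ?n = "nat \<lfloor>t * real N\<rfloor>"
  have "t * real N \<le> 1 * real N"
    using t by (intro mult_right_mono) auto
  then have n_le: "?n \<le> card {..<N}"
    by (simp add: nat_le_iff floor_le_iff)
  have "reached_density t N L - mean =
      (real (card (reached {..<N} L ?n)) - real (card {..<N}) * mean) / real N" for L
    using \<open>N > 0\<close> by (simp add: reached_density_def diff_divide_distrib)
  then have "measure_pmf.expectation (thresholds N) (\<lambda>L. (reached_density t N L - mean)\<^sup>2) =
      measure_pmf.expectation (thresholds N)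
        (\<lambda>L. (real (card (reached {..<N} L ?n)) - real (card {..<N}) * mean)\<^sup>2) / (real N)\<^sup>2"
    by (simp add: power_divide)
  also have "\<dots> \<le> real (card {..<N}) / (real N)\<^sup>2"
    using expect_card_reached_deviation_le[OF n_le]
    by (intro divide_right_mono) (simp_all add: threshold_law_def mean_def)
  finally show ?thesis
    using \<open>N > 0\<close> by (simp add: power2_eq_square)
qed

lemma reached_density_conv:
  assumes t: "0 \<le> t" "t < 1"
  shows "conv_in_prob thresholds (reached_density t) (reach_limit t)"
proof (rule conv_in_prob_L2_close[OF _ _ bounded_range_reached_density])
  let ?mean = "\<lambda>N. 1 - exp (- fire_rate beta N (nat \<lfloor>t * real N\<rfloor>))"
  show "conv_in_prob thresholds (\<lambda>N _. ?mean N) (reach_limit t)"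
    unfolding reach_limit_def
    using fire_rate_tendsto[OF filterlim_ident floor_density_tendsto[OF t(1)] t(2)]
    by (intro conv_in_prob_const tendsto_intros)
  show "(\<lambda>N. measure_pmf.expectation (thresholds N) (\<lambda>L. (reached_density t N L - ?mean N)\<^sup>2)) \<longlonglongrightarrow> 0"
  proof (rule tendsto_sandwich[OF _ _ tendsto_const lim_1_over_n])
    show "\<forall>\<^sub>F N in sequentially.
      measure_pmf.expectation (thresholds N) (\<lambda>L. (reached_density t N L - ?mean N)\<^sup>2) \<le> 1 / real N"
      using eventually_gt_at_top[of 0]
      by eventually_elim (rule expectation_reached_density_deviation_le[OF t])
  qed simp
qed simp

definition closure_density :: "nat \<Rightarrow> (nat \<times> nat \<Rightarrow> nat) \<Rightarrow> real" where
  "closure_density N L = real (card (threshold_closure {..<N} L)) / real N"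

lemma reached_density_le:
  assumes "N > 0" "0 \<le> t" "t \<le> closure_density N L"
  shows "reached_density t N L \<le> closure_density N L"
proof -
  interpret threshold_system "{..<N}" "fire_rate beta N"
    by (rule threshold_system_fire_rate)
  have "t * real N \<le> real (card (threshold_closure {..<N} L))"
    using assms by (simp add: closure_density_def pos_le_divide_eq)
  then have "nat \<lfloor>t * real N\<rfloor> \<le> card (threshold_closure {..<N} L)"
    by linarith
  then have "card (reached {..<N} L (nat \<lfloor>t * real N\<rfloor>)) \<le>
      card (reached {..<N} L (card (threshold_closure {..<N} L)))"
    by (intro card_mono reached_mono finite_subset[OF reached_subset]) auto
  also have "\<dots> \<le> card (threshold_closure {..<N} L)"
    by (rule card_reached_threshold_closure)
  finally show ?thesis
    by (simp add: reached_density_def closure_density_def divide_right_mono)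
qed

lemma reached_density_ge:
  assumes "N > 0" "0 \<le> t" "t < 1" "t < closure_density N L"
  shows "t \<le> reached_density t N L"
proof -
  interpret threshold_system "{..<N}" "fire_rate beta N"
    by (rule threshold_system_fire_rate)
  let ?n = "nat \<lfloor>t * real N\<rfloor>"
  have tN: "0 \<le> t * real N" "t * real N \<le> real N"
    using assms mult_right_mono[of t 1 "real N"] by auto
  then have "?n \<le> card {..<N}"
    by (simp add: nat_le_iff floor_le_iff)
  moreover have "t * real N < real (card (threshold_closure {..<N} L))"
    using assms by (simp add: closure_density_def pos_less_divide_eq)
  then have "\<not> card (threshold_closure {..<N} L) \<le> ?n"
    using tN(1) by linarith
  ultimately have "card (reached {..<N} L ?n) > ?n"
    using card_threshold_closure_le by force
  then have "t * real N \<le> real (card (reached {..<N} L ?n))"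
    using tN(1) by linarith
  then show ?thesis
    using assms(1) by (simp add: reached_density_def pos_le_divide_eq)
qed

lemma closure_density_upper:
  assumes t: "0 \<le> t" "t < 1" and neg: "drift t < 0"
  shows "vanishes_in_prob thresholds (\<lambda>N L. closure_density N L > t)"
proof -
  define d where "d = t - reach_limit t"
  have "d > 0"
    using neg t(2) by (simp add: d_def drift_less_0_iff)
  have "vanishes_in_prob thresholds (\<lambda>N L. \<bar>reached_density t N L - reach_limit t\<bar> > d / 2)"
    using reached_density_conv[OF t] half_gt_zero[OF \<open>d > 0\<close>] by (rule conv_in_prob_imp_vanishes)
  then show ?thesis
  proof (rule vanishes_in_prob_mono)
    show "\<forall>\<^sub>F N in sequentially. \<forall>L. closure_density N L > t \<longrightarrow>
        \<bar>reached_density t N L - reach_limit t\<bar> > d / 2"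
      using eventually_gt_at_top[of 0]
    proof (eventually_elim, intro allI impI)
      fix N :: nat and L assume "N > 0" "closure_density N L > t"
      then have "t \<le> reached_density t N L"
        using t by (intro reached_density_ge) auto
      then show "\<bar>reached_density t N L - reach_limit t\<bar> > d / 2"
        using \<open>d > 0\<close> by (simp add: d_def)
    qed
  qed
qed

lemma drift_pos_gap:
  assumes s: "0 \<le> s" "s < 1" and pos: "\<And>t. 0 \<le> t \<Longrightarrow> t \<le> s \<Longrightarrow> drift t > 0"
  obtains d where "d > 0" "\<And>t. 0 \<le> t \<Longrightarrow> t \<le> s \<Longrightarrow> t + d \<le> reach_limit t"
proof -
  define gap where "gap t = reach_limit t - t" for t
  have "continuous_on {0..s} gap"
    unfolding gap_def reach_limit_def using s
    by (intro continuous_intros continuous_at_imp_continuous_on ballI isCont_beta_deriv) auto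
  then obtain x where "x \<in> {0..s}" and gap_le: "\<And>t. t \<in> {0..s} \<Longrightarrow> gap x \<le> gap t"
    using continuous_attains_inf[of "{0..s}" gap] s by auto
  have "gap x > 0"
    using pos[of x] \<open>x \<in> {0..s}\<close> s by (simp add: gap_def drift_greater_0_iff)
  moreover have "t + gap x \<le> reach_limit t" if "0 \<le> t" "t \<le> s" for t
    using gap_le[of t] that by (simp add: gap_def)
  ultimately show ?thesis
    using that by blast
qed

text \<open>If the closure stops below \<open>s N\<close>, it stops within \<open>d / 2\<close> above some grid point \<open>i d / 2\<close>,
  where the number of reached vertices falls short of its mean by at least half of the gap \<open>d\<close>.\<close>

lemma closure_density_grid:
  assumes "N > 0" "d > 0" and gap: "\<And>t. 0 \<le> t \<Longrightarrow> t \<le> s \<Longrightarrow> t + d \<le> reach_limit t"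
    and less: "closure_density N L < s"
  obtains i :: nat where "real i * (d / 2) \<le> s"
    "\<bar>reached_density (real i * (d / 2)) N L - reach_limit (real i * (d / 2))\<bar> > d / 3"
proof -
  define i where "i = nat \<lfloor>closure_density N L / (d / 2)\<rfloor>"
  let ?t = "real i * (d / 2)"
  have "real i \<le> closure_density N L / (d / 2)" "closure_density N L / (d / 2) < real i + 1"
    using \<open>d > 0\<close> by (auto simp: i_def closure_density_def)
  then have t_le: "?t \<le> closure_density N L" and less_t: "closure_density N L < ?t + d / 2"
    using \<open>d > 0\<close> by (simp_all add: field_simps)
  have "0 \<le> ?t" "?t \<le> s"
    using t_le less \<open>d > 0\<close> by auto
  moreover from this have "\<bar>reached_density ?t N L - reach_limit ?t\<bar> > d / 3"
    using reached_density_le[OF \<open>N > 0\<close> _ t_le] less_t gap[of ?t] \<open>d > 0\<close> by simp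
  ultimately show ?thesis
    using that by blast
qed

lemma closure_density_lower:
  assumes s: "0 \<le> s" "s < 1" and pos: "\<And>t. 0 \<le> t \<Longrightarrow> t \<le> s \<Longrightarrow> drift t > 0"
  shows "vanishes_in_prob thresholds (\<lambda>N L. closure_density N L < s)"
proof -
  obtain d where "d > 0" and gap: "\<And>t. 0 \<le> t \<Longrightarrow> t \<le> s \<Longrightarrow> t + d \<le> reach_limit t"
    using drift_pos_gap[OF s pos] by blast
  define grid where "grid = {i::nat. real i * (d / 2) \<le> s}"
  define deviates where "deviates i N L \<longleftrightarrow>
    \<bar>reached_density (real i * (d / 2)) N L - reach_limit (real i * (d / 2))\<bar> > d / 3"
    for i N L
  have "grid \<subseteq> {..nat \<lfloor>s / (d / 2)\<rfloor>}"
    using \<open>d > 0\<close> by (auto simp: grid_def le_nat_floor field_simps)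
  then have "finite grid"
    by (rule finite_subset) simp
  moreover have "vanishes_in_prob thresholds (deviates i)" if "i \<in> grid" for i
    unfolding deviates_def using that s \<open>d > 0\<close>
    by (intro conv_in_prob_imp_vanishes[OF reached_density_conv]) (auto simp: grid_def)
  ultimately have "vanishes_in_prob thresholds (\<lambda>N L. \<exists>i\<in>grid. deviates i N L)"
    by (rule vanishes_in_prob_bex)
  then show ?thesis
  proof (rule vanishes_in_prob_mono)
    show "\<forall>\<^sub>F N in sequentially. \<forall>L. closure_density N L < s \<longrightarrow> (\<exists>i\<in>grid. deviates i N L)"
      using eventually_gt_at_top[of 0]
    proof (eventually_elim, intro allI impI)
      fix N :: nat and L assume "N > 0" "closure_density N L < s"
      then show "\<exists>i\<in>grid. deviates i N L"
        using closure_density_grid[OF _ \<open>d > 0\<close> gap] unfolding grid_def deviates_def by blast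
    qed
  qed
qed

end

locale edge_weights_no_zero = edge_weights +
  assumes no_zero: "\<And>t. 0 \<le> t \<Longrightarrow> t < tstar beta \<Longrightarrow> drift t \<noteq> 0"
begin

lemma drift_pos_below_tstar: "0 \<le> t \<Longrightarrow> t < tstar beta \<Longrightarrow> drift t > 0"
  using drift_nonneg_below_tstar[of t] no_zero[of t] by (simp add: less_le)

lemma closure_density_below_tstar:
  assumes "s < tstar beta"
  shows "vanishes_in_prob thresholds (\<lambda>N L. closure_density N L < s)"
proof (cases "0 \<le> s")
  case True
  then show ?thesis
    using assms tstar_less_1 drift_pos_below_tstar by (intro closure_density_lower) auto
next
  case False
  then have "\<not> closure_density N L < s" for N L
    by (simp add: closure_density_def not_less order_trans[of s 0])
  then show ?thesis
    by (simp add: vanishes_in_prob_def)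
qed

lemma closure_density_above_tstar:
  assumes "tstar beta < u"
  shows "vanishes_in_prob thresholds (\<lambda>N L. closure_density N L > u)"
proof -
  obtain t where t: "tstar beta \<le> t" "t < u" "t < 1" "drift t < 0"
    using drift_neg_above_tstar[OF assms] .
  then have "vanishes_in_prob thresholds (\<lambda>N L. closure_density N L > t)"
    using tstar_nonneg by (intro closure_density_upper) auto
  then show ?thesis
    by (rule vanishes_in_prob_mono) (use t(2) in auto)
qed

lemma closure_density_conv: "conv_in_prob thresholds closure_density (tstar beta)"
  unfolding conv_in_prob_iff_vanishes
proof (intro allI impI)
  fix e :: real assume "e > 0"
  then have "vanishes_in_prob thresholds
      (\<lambda>N L. closure_density N L < tstar beta - e \<or> closure_density N L > tstar beta + e)"
    by (intro vanishes_in_prob_disj closure_density_below_tstar closure_density_above_tstar) auto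
  then show "vanishes_in_prob thresholds (\<lambda>N L. \<bar>closure_density N L - tstar beta\<bar> > e)"
    by (rule vanishes_in_prob_mono) (intro always_eventually allI impI, arith)
qed

theorem patch_closure_density_conv:
  "conv_in_prob (poisson_hypergraph beta)
    (\<lambda>N L. real (card (patch_closure {..<N} L)) / real N) (tstar beta)"
  using closure_density_conv
  unfolding conv_in_prob_def closure_density_def
    prob_patch_closure[of _ "\<lambda>S. \<bar>real (card S) / real _ - tstar beta\<bar> > _"] .

end

section \<open>The number of essential edges\<close>

definition edges_of_size :: "nat set \<Rightarrow> nat \<Rightarrow> nat set set" where
  "edges_of_size W N = {A \<in> edge_sets {..<N}. card A \<in> W}"

definition num_essential :: "nat set \<Rightarrow> nat \<Rightarrow> (nat set \<Rightarrow> nat) \<Rightarrow> real" where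
  "num_essential W N L = (\<Sum>A\<in>edges_of_size W N. of_bool (essential {..<N} A L))"

lemma bounded_range_num_essential: "bounded (range (num_essential W N))"
  unfolding num_essential_def by (intro bounded_range_intros)

lemma essential_count_eq_num_essential:
  "k \<ge> 1 \<Longrightarrow> real (essential_count N k L) = num_essential {k} N L"
  by (simp add: essential_count_eq num_essential_def edges_of_size_def)

lemma essential_total_eq_num_essential: "real (essential_total N L) = num_essential UNIV N L"
  by (simp add: essential_total_eq num_essential_def edges_of_size_def)

context edge_weights
begin

definition essential_compensator :: "nat set \<Rightarrow> nat \<Rightarrow> (nat set \<Rightarrow> nat) \<Rightarrow> real" where
  "essential_compensator W N L = (\<Sum>A\<in>edges_of_size W N.
    edge_rate beta N (card A) * of_bool (card (A - patch_closure {..<N} L) = 1))"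

lemma bounded_range_essential_compensator: "bounded (range (essential_compensator W N))"
  unfolding essential_compensator_def by (intro bounded_range_intros)

lemma sum_edge_rate_one_missing:
  assumes "S \<subseteq> {..<N}"
  shows "(\<Sum>A\<in>edges_of_size W N. edge_rate beta N (card A) * of_bool (card (A - S) = 1)) =
    real (N - card S) * fire_rate (weights_on W beta) N (card S)"
proof -
  have escaping:
    "escaping edge_fires (edge_sets {..<N}) S {..<N} = {A \<in> edge_sets {..<N}. card (A - S) = 1}"
    by (auto simp: escaping_def edge_fires_def card_1_singleton_iff edge_sets_def)
  have "(\<Sum>A\<in>edges_of_size W N. edge_rate beta N (card A) * of_bool (card (A - S) = 1)) =
      (\<Sum>A | A \<in> edge_sets {..<N} \<and> card (A - S) = 1. edge_rate (weights_on W beta) N (card A))"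
    by (rule sum.mono_neutral_cong)
       (auto simp: edges_of_size_def finite_edge_sets edge_rate_def weights_on_def)
  also have "\<dots> = real (card ({..<N} - S)) * fire_rate (weights_on W beta) N (card S)"
    unfolding escaping[symmetric] sum_escaping_edges[OF finite_lessThan assms subset_refl]
      fire_rate_def ..
  finally show ?thesis
    using assms by (simp add: card_Diff_subset finite_subset)
qed

lemma sum_edge_rate_card_edges_of_size_le:
  "(\<Sum>A\<in>edges_of_size W N. edge_rate beta N (card A) * real (card A)) \<le> real N * beta_deriv beta 1"
proof -
  have "(\<Sum>A\<in>edges_of_size W N. edge_rate beta N (card A) * real (card A)) \<le>
      (\<Sum>A\<in>edge_sets {..<N}. edge_rate beta N (card A) * real (card A))"
    by (rule sum_mono2)
       (auto simp: finite_edge_sets edges_of_size_def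
         intro!: mult_nonneg_nonneg edge_rate_nonneg card_edge_set(1)[OF finite_lessThan])
  then show ?thesis
    using sum_edge_rate_card_le[of N] by linarith
qed

lemma sum_edge_rate_edges_of_size_le:
  "(\<Sum>A\<in>edges_of_size W N. edge_rate beta N (card A)) \<le> real N * beta_deriv beta 1"
proof (rule order_trans[OF sum_mono sum_edge_rate_card_edges_of_size_le])
  fix A assume "A \<in> edges_of_size W N"
  then have "1 \<le> card A"
    using card_edge_set(1)[OF finite_lessThan] by (auto simp: edges_of_size_def)
  then show "edge_rate beta N (card A) \<le> edge_rate beta N (card A) * real (card A)"
    using mult_left_mono[of 1 "real (card A)" "edge_rate beta N (card A)"] edge_rate_nonneg by simp
qed

lemma expectation_essential_deviation_le:
  "measure_pmf.expectation (poisson_hypergraph beta N)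
    (\<lambda>L. (num_essential W N L - essential_compensator W N L)\<^sup>2) \<le>
    real N * beta_deriv beta 1 + real N * beta_deriv beta 1 * sqrt (real N * beta_deriv beta 1)"
proof -
  interpret random_hypergraph "{..<N}" "\<lambda>A. edge_rate beta N (card A)"
    by (rule random_hypergraph_edge_rate)
  let ?r = "\<lambda>A. edge_rate beta N (card A)"
  let ?K = "edges_of_size W N"
  have K_subset: "?K \<subseteq> edge_sets {..<N}"
    by (auto simp: edges_of_size_def)
  have "measure_pmf.expectation (poisson_hypergraph beta N)
      (\<lambda>L. (num_essential W N L - essential_compensator W N L)\<^sup>2) =
    expect (\<lambda>L. ((\<Sum>A\<in>?K. of_bool (essential {..<N} A L)) -
      (\<Sum>A\<in>?K. ?r A * of_bool (card (A - patch_closure {..<N} L) = 1)))\<^sup>2)"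
    by (simp only: poisson_hypergraph_eq num_essential_def essential_compensator_def)
  also have "\<dots> \<le> sum ?r ?K + (\<Sum>A\<in>?K. ?r A * real (card A)) * sqrt (sum ?r ?K)"
    by (rule expect_essential_deviation_le[OF K_subset])
  also have "\<dots> \<le> real N * beta_deriv beta 1 +
      real N * beta_deriv beta 1 * sqrt (real N * beta_deriv beta 1)"
    using beta_deriv_1_nonneg K_subset rate_nonneg
      sum_edge_rate_edges_of_size_le[of N W] sum_edge_rate_card_edges_of_size_le[of N W]
    by (intro add_mono mult_mono) (auto intro: sum_nonneg)
  finally show ?thesis .
qed

lemma expectation_essential_density_deviation_tendsto_0:
  "(\<lambda>N. measure_pmf.expectation (poisson_hypergraph beta N)
    (\<lambda>L. (num_essential W N L / real N - essential_compensator W N L / real N)\<^sup>2)) \<longlonglongrightarrow> 0"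
proof (rule tendsto_sandwich[OF _ _ tendsto_const])
  define M where "M = beta_deriv beta 1"
  show "\<forall>\<^sub>F N in sequentially. measure_pmf.expectation (poisson_hypergraph beta N)
      (\<lambda>L. (num_essential W N L / real N - essential_compensator W N L / real N)\<^sup>2)
    \<le> M / real N + M * sqrt M / sqrt (real N)"
    using eventually_gt_at_top[of 0]
  proof eventually_elim
    case (elim N)
    have "measure_pmf.expectation (poisson_hypergraph beta N)
        (\<lambda>L. (num_essential W N L / real N - essential_compensator W N L / real N)\<^sup>2) =
      measure_pmf.expectation (poisson_hypergraph beta N)
        (\<lambda>L. (num_essential W N L - essential_compensator W N L)\<^sup>2) / (real N)\<^sup>2"
      by (simp add: diff_divide_distrib[symmetric] power_divide)
    also have "\<dots> \<le> (real N * M + real N * M * sqrt (real N * M)) / (real N)\<^sup>2"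
      unfolding M_def by (intro divide_right_mono expectation_essential_deviation_le) simp
    also have "\<dots> = M / real N + M * sqrt M * (sqrt (real N) / real N)"
      using elim by (simp add: real_sqrt_mult power2_eq_square add_divide_distrib mult_ac)
    also have "sqrt (real N) / real N = 1 / sqrt (real N)"
      using elim by (simp add: divide_eq_eq eq_divide_eq)
    finally show ?case
      by simp
  qed
  have "(\<lambda>N. M * sqrt M / sqrt (real N)) \<longlonglongrightarrow> 0"
    by (intro tendsto_divide_0[OF tendsto_const] filterlim_at_top_imp_at_infinity
        filterlim_compose[OF sqrt_at_top filterlim_real_sequentially])
  from tendsto_add[OF lim_const_over_n[of M] this]
  show "(\<lambda>N. M / real N + M * sqrt M / sqrt (real N)) \<longlonglongrightarrow> 0"
    by simp
qed simp

end

context edge_weights_no_zero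
begin

lemma essential_compensator_conv:
  "conv_in_prob (poisson_hypergraph beta) (\<lambda>N L. essential_compensator W N L / real N)
    ((1 - tstar beta) * beta_deriv (weights_on W beta) (tstar beta))"
proof -
  interpret restricted: edge_weights "weights_on W beta"
    by (rule edge_weights_weights_on)
  define f :: "nat \<times> nat \<Rightarrow> real" where
    "f = (\<lambda>p. (1 - real (snd p) / real (fst p)) * fire_rate (weights_on W beta) (fst p) (snd p))"
  have "(f \<longlongrightarrow> (1 - tstar beta) * beta_deriv (weights_on W beta) (tstar beta))
      (density_filter (tstar beta))"
    unfolding f_def using tstar_less_1
    by (intro tendsto_mult tendsto_diff tendsto_const tendsto_density_filter
        restricted.fire_rate_tendsto filterlim_fst_density_filter)
  then have "conv_in_prob (poisson_hypergraph beta) (\<lambda>N L. f (N, card (patch_closure {..<N} L)))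
      ((1 - tstar beta) * beta_deriv (weights_on W beta) (tstar beta))"
    by (rule conv_in_prob_compose_density[OF patch_closure_density_conv])
  moreover have "essential_compensator W N L / real N = f (N, card (patch_closure {..<N} L))" for N L
  proof -
    have "card (patch_closure {..<N} L) \<le> N"
      using card_mono[OF finite_lessThan patch_closure_subset] by simp
    then show ?thesis
      unfolding essential_compensator_def sum_edge_rate_one_missing[OF patch_closure_subset]
      by (cases "N = 0")
         (auto simp: f_def fire_rate_def edge_rate_def of_nat_diff field_simps)
  qed
  ultimately show ?thesis
    by simp
qed

theorem num_essential_conv:
  "conv_in_prob (poisson_hypergraph beta) (\<lambda>N L. num_essential W N L / real N)
    ((1 - tstar beta) * beta_deriv (weights_on W beta) (tstar beta))"
  unfolding divide_inverse
  by (intro conv_in_prob_L2_close[OF essential_compensator_conv[unfolded divide_inverse]]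
      expectation_essential_density_deviation_tendsto_0[unfolded divide_inverse]
      bounded_range_intros bounded_range_num_essential bounded_range_essential_compensator)

end

theorem theorem3:
  fixes beta :: "nat \<Rightarrow> real"
  assumes nonneg: "\<And>k. k \<ge> 1 \<Longrightarrow> beta k \<ge> 0"
    and summ: "summable (\<lambda>k. real (Suc k) * beta (Suc k))"
    and nozero: "\<And>t. 0 \<le> t \<Longrightarrow> t < tstar beta \<Longrightarrow>
                   deriv (beta_fun beta) t + ln (1 - t) \<noteq> 0"
  shows "(\<forall>k\<ge>1. conv_in_prob (poisson_hypergraph beta)
            (\<lambda>N Lam. real (essential_count N k Lam) / real N)
            (real k * (1 - tstar beta) * tstar beta ^ (k - 1) * beta k)) \<and>
         conv_in_prob (poisson_hypergraph beta)
            (\<lambda>N Lam. real (essential_total N Lam) / real N)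
            (- (1 - tstar beta) * ln (1 - tstar beta))"
proof -
  interpret edge_weights beta
    using nonneg summ by unfold_locales
  interpret edge_weights_no_zero beta
    using nozero tstar_less_1 by unfold_locales (auto simp: drift_def deriv_beta_fun)
  have beta_deriv_tstar: "beta_deriv beta (tstar beta) = - ln (1 - tstar beta)"
    using drift_tstar by (simp add: drift_def)
  have "conv_in_prob (poisson_hypergraph beta) (\<lambda>N Lam. real (essential_count N k Lam) / real N)
      (real k * (1 - tstar beta) * tstar beta ^ (k - 1) * beta k)" if "k \<ge> 1" for k
    using num_essential_conv[of "{k}"] that
    by (simp add: essential_count_eq_num_essential beta_deriv_weights_on_singleton mult_ac)
  moreover have "conv_in_prob (poisson_hypergraph beta)
      (\<lambda>N Lam. real (essential_total N Lam) / real N)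
      (- (1 - tstar beta) * ln (1 - tstar beta))"
    using num_essential_conv[of UNIV] unfolding weights_on_UNIV beta_deriv_tstar
    by (simp only: essential_total_eq_num_essential mult_minus_left mult_minus_right)
  ultimately show ?thesis
    by blast
qed

end
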